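(* Let $n=de$ be a squarefree positive integer, where $d,e$ are positive integers and $e=p_1p_2\cdots p_m$ with $p_1,\dots,p_m$ distinct primes. Let $t$ be an integer whose multiplicative order modulo $e$ is $d$, and let $G$ be the group with presentation $$\langle x,y \mid x^d=\mathrm{id},\ y^e=\mathrm{id},\ x^{-1}yx=y^t\rangle .$$ For $1\le i\le m$ let $d_i$ be the multiplicative order of $t$ modulo $p_i$, and for each positive integer $j$ put $\alpha_j=\prod_{i:\, d_i\mid j}p_i$. Then the number $k(G)$ of conjugacy classes of $G$ satisfies $$k(G)=\sum_{k=1}^d\sum_{a=1}^d \frac{1}{k}\left(\sum_{l=0}^{k-1}(-1)^l\sum_{1\le j_1<j_2<\cdots<j_l<k}\alpha_{(d,a,k,j_1,j_2,\ldots,j_l)}\right)= d\sum_{j\mid d}\frac{\alpha_j}{j^2}\sum_{s\mid \frac{d}{j}}\frac{\mu(s)}{s^2},$$ where $\mu$ denotes the Möbius function.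
   Context: $(a_1,\dots,a_r)$ used as an index denotes the greatest common divisor of the positive integers $a_1,\dots,a_r$. The innermost sum in the first expression runs over all strictly increasing sequences $(j_1,\dots,j_l)$ of $l$ integers in $\{1,\dots,k-1\}$; for $l=0$ it consists of the single term $\alpha_{(d,a,k)}$. An empty product equals $1$. The sums over $j\mid d$ and $s\mid d/j$ run over positive divisors. *)

theory Defs
  imports "HOL-Number_Theory.Number_Theory" "HOL-Computational_Algebra.Squarefree" "HOL-Algebra.Group_Action"
begin

section \<open>Groups given by generators and relations\<close>

datatype 'a letter = Gen 'a | Inv 'a

primrec letter_inv :: "'a letter \<Rightarrow> 'a letter" where
  "letter_inv (Gen a) = Inv a"
| "letter_inv (Inv a) = Gen a"

definition word_inv :: "'a letter list \<Rightarrow> 'a letter list" where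
  "word_inv w = rev (map letter_inv w)"

definition word_pow :: "'a letter list \<Rightarrow> int \<Rightarrow> 'a letter list" where
  "word_pow w k =
     (if k \<ge> 0 then concat (replicate (nat k) w)
      else concat (replicate (nat (- k)) (word_inv w)))"

text \<open>The smallest congruence on the free monoid of words in the letters
  \<open>a\<close>, \<open>a\<^sup>-\<^sup>1\<close> that makes these letters mutually inverse and identifies the two
  sides of every relation in \<open>R\<close>.\<close>

inductive word_eq :: "('a letter list \<times> 'a letter list) set
    \<Rightarrow> 'a letter list \<Rightarrow> 'a letter list \<Rightarrow> bool" for R where
  refl: "word_eq R u u"
| sym: "word_eq R u v \<Longrightarrow> word_eq R v u"
| trans: "word_eq R u v \<Longrightarrow> word_eq R v w \<Longrightarrow> word_eq R u w"
| cancel: "word_eq R (u @ [l, letter_inv l] @ v) (u @ v)"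
| rel: "(r, s) \<in> R \<Longrightarrow> word_eq R (u @ r @ v) (u @ s @ v)"

definition word_class :: "('a letter list \<times> 'a letter list) set
    \<Rightarrow> 'a letter list \<Rightarrow> 'a letter list set" where
  "word_class R w = {v. word_eq R w v}"

text \<open>The generators are all elements of the type \<open>'a\<close>.\<close>

definition presented_group ::
  "('a letter list \<times> 'a letter list) set \<Rightarrow> 'a letter list set monoid" where
  "presented_group R =
     \<lparr>carrier = range (word_class R),
      mult = (\<lambda>A B. \<Union>u\<in>A. \<Union>v\<in>B. word_class R (u @ v)),
      one = word_class R []\<rparr>"

text \<open>The value of a word in a group, given the values of the generators.\<close>

fun letter_val :: "('b, 'c) monoid_scheme \<Rightarrow> ('a \<Rightarrow> 'b) \<Rightarrow> 'a letter \<Rightarrow> 'b" where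
  "letter_val H f (Gen a) = f a"
| "letter_val H f (Inv a) = inv\<^bsub>H\<^esub> (f a)"

fun word_val :: "('b, 'c) monoid_scheme \<Rightarrow> ('a \<Rightarrow> 'b) \<Rightarrow> 'a letter list \<Rightarrow> 'b" where
  "word_val H f [] = \<one>\<^bsub>H\<^esub>"
| "word_val H f (l # w) = letter_val H f l \<otimes>\<^bsub>H\<^esub> word_val H f w"

lemma word_eq_append_left: "word_eq R u v \<Longrightarrow> word_eq R (w @ u) (w @ v)"
proof (induction rule: word_eq.induct)
  case (cancel u l v)
  show ?case using word_eq.cancel[of R "w @ u" l v] by simp
next
  case (rel r s u v)
  then show ?case using word_eq.rel[of r s R "w @ u" v] by simp
qed (auto intro: word_eq.refl word_eq.sym word_eq.trans)

lemma word_eq_append_right: "word_eq R u v \<Longrightarrow> word_eq R (u @ w) (v @ w)"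
proof (induction rule: word_eq.induct)
  case (cancel u l v)
  show ?case using word_eq.cancel[of R u l "v @ w"] by simp
next
  case (rel r s u v)
  then show ?case using word_eq.rel[of r s R u "v @ w"] by simp
qed (auto intro: word_eq.refl word_eq.sym word_eq.trans)

lemma word_eq_append:
  "word_eq R u u' \<Longrightarrow> word_eq R v v' \<Longrightarrow> word_eq R (u @ v) (u' @ v')"
  by (blast intro: word_eq.trans word_eq_append_left word_eq_append_right)

lemma word_class_eq_iff: "word_class R u = word_class R v \<longleftrightarrow> word_eq R u v"
  unfolding word_class_def
  by (auto intro: word_eq.refl word_eq.sym word_eq.trans)

lemma mem_word_class_iff: "v \<in> word_class R u \<longleftrightarrow> word_eq R u v"
  by (simp add: word_class_def)

lemma letter_inv_letter_inv [simp]: "letter_inv (letter_inv l) = l"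
  by (cases l) auto

lemma word_inv_right: "word_eq R (w @ word_inv w) []"
proof (induction w)
  case Nil
  show ?case by (simp add: word_inv_def word_eq.refl)
next
  case (Cons l w)
  have "word_eq R ([l] @ (w @ word_inv w) @ [letter_inv l]) ([l] @ [] @ [letter_inv l])"
    using Cons by (blast intro: word_eq_append word_eq.refl)
  moreover have "word_eq R [l, letter_inv l] []"
    using word_eq.cancel[of R "[]" l "[]"] by simp
  ultimately show ?case
    by (auto simp: word_inv_def intro: word_eq.trans)
qed

lemma word_inv_word_inv [simp]: "word_inv (word_inv w) = w"
  by (simp add: word_inv_def rev_map o_def)

lemma word_inv_left: "word_eq R (word_inv w @ w) []"
  using word_inv_right[of R "word_inv w"] by simp

lemma carrier_presented_group [simp]:
  "carrier (presented_group R) = range (word_class R)"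
  by (simp add: presented_group_def)

lemma one_presented_group [simp]: "\<one>\<^bsub>presented_group R\<^esub> = word_class R []"
  by (simp add: presented_group_def)

lemma mult_presented_group [simp]:
  "word_class R u \<otimes>\<^bsub>presented_group R\<^esub> word_class R v = word_class R (u @ v)"
proof -
  have eq: "word_class R (u' @ v') = word_class R (u @ v)"
    if "u' \<in> word_class R u" "v' \<in> word_class R v" for u' v'
    using that word_eq_append[of R u u' v v']
    by (simp add: mem_word_class_iff word_class_eq_iff word_eq.sym)
  have "u \<in> word_class R u" "v \<in> word_class R v"
    by (simp_all add: mem_word_class_iff word_eq.refl)
  then have "(\<Union>u'\<in>word_class R u. \<Union>v'\<in>word_class R v. word_class R (u' @ v')) = word_class R (u @ v)"
    using eq by blast
  then show ?thesis
    by (simp add: presented_group_def)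
qed

lemma group_presented_group: "group (presented_group R)"
proof (rule groupI)
  fix x assume "x \<in> carrier (presented_group R)"
  then obtain w where "x = word_class R w" by auto
  then have "word_class R (word_inv w) \<otimes>\<^bsub>presented_group R\<^esub> x = \<one>\<^bsub>presented_group R\<^esub>"
    by (simp add: word_class_eq_iff word_inv_left)
  then show "\<exists>y\<in>carrier (presented_group R).
      y \<otimes>\<^bsub>presented_group R\<^esub> x = \<one>\<^bsub>presented_group R\<^esub>"
    by auto
qed auto

lemma inv_presented_group:
  "inv\<^bsub>presented_group R\<^esub> (word_class R w) = word_class R (word_inv w)"
proof -
  interpret group "presented_group R" by (rule group_presented_group)
  show ?thesis
    by (rule inv_equality) (auto simp: word_class_eq_iff word_inv_left)
qed

lemma presented_group_relation: "(r, s) \<in> R \<Longrightarrow> word_class R r = word_class R s"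
  using word_eq.rel[of r s R "[]" "[]"] by (simp add: word_class_eq_iff)

context group
begin

lemma letter_val_closed: "range f \<subseteq> carrier G \<Longrightarrow> letter_val G f l \<in> carrier G"
  by (cases l) auto

lemma word_val_closed: "range f \<subseteq> carrier G \<Longrightarrow> word_val G f w \<in> carrier G"
  by (induction w) (auto simp: letter_val_closed)

lemma word_val_append:
  assumes "range f \<subseteq> carrier G"
  shows "word_val G f (u @ v) = word_val G f u \<otimes> word_val G f v"
  by (induction u) (auto simp: assms letter_val_closed word_val_closed m_assoc)

lemma letter_val_inv:
  assumes "range f \<subseteq> carrier G"
  shows "letter_val G f l \<otimes> letter_val G f (letter_inv l) = \<one>"
proof (cases l)
  case (Gen a)
  moreover have "f a \<in> carrier G" using assms by auto
  ultimately show ?thesis by simp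
next
  case (Inv a)
  moreover have "f a \<in> carrier G" using assms by auto
  ultimately show ?thesis by simp
qed

lemma word_val_cong:
  assumes f: "range f \<subseteq> carrier G"
    and R: "\<And>r s. (r, s) \<in> R \<Longrightarrow> word_val G f r = word_val G f s"
    and "word_eq R u v"
  shows "word_val G f u = word_val G f v"
  using assms(3)
proof (induction rule: word_eq.induct)
  case (cancel u l v)
  have "word_val G f [l, letter_inv l] = \<one>"
    by (simp add: f letter_val_closed letter_val_inv)
  then show ?case
    using f by (simp only: word_val_append word_val_closed l_one)
next
  case (rel r s u v)
  then show ?case using R[of r s] f by (simp add: word_val_append)
qed auto

text \<open>The universal property of the presentation (von Dyck).\<close>

lemma presented_group_universal:
  assumes f: "range f \<subseteq> carrier G"
    and R: "\<And>r s. (r, s) \<in> R \<Longrightarrow> word_val G f r = word_val G f s"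
  shows "\<exists>h\<in>hom (presented_group R) G. \<forall>a. h (word_class R [Gen a]) = f a"
proof -
  define h where "h = (\<lambda>A. word_val G f (SOME w. w \<in> A))"
  have h: "h (word_class R w) = word_val G f w" for w
  proof -
    have "(SOME v. v \<in> word_class R w) \<in> word_class R w"
      by (rule someI[of _ w]) (simp add: mem_word_class_iff word_eq.refl)
    then show ?thesis
      using word_val_cong[OF f R] unfolding h_def mem_word_class_iff by metis
  qed
  have "h \<in> hom (presented_group R) G"
    by (auto simp: hom_def h word_val_append[OF f] word_val_closed[OF f])
  moreover have "h (word_class R [Gen a]) = f a" for a
    using range_subsetD[OF f, of a] by (simp add: h)
  ultimately show ?thesis by blast
qed

end

section \<open>The group \<open>\<langle>x, y | x\<^sup>d = 1, y\<^sup>e = 1, x\<^sup>-\<^sup>1yx = y\<^sup>t\<rangle>\<close>\<close>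

datatype gen_xy = X | Y

definition metacyclic_relations ::
  "nat \<Rightarrow> nat \<Rightarrow> int \<Rightarrow> (gen_xy letter list \<times> gen_xy letter list) set" where
  "metacyclic_relations d e t =
     {(word_pow [Gen X] (int d), []),
      (word_pow [Gen Y] (int e), []),
      ([Inv X, Gen Y, Gen X], word_pow [Gen Y] t)}"

definition metacyclic_group :: "nat \<Rightarrow> nat \<Rightarrow> int \<Rightarrow> gen_xy letter list set monoid" where
  "metacyclic_group d e t = presented_group (metacyclic_relations d e t)"

section \<open>Conjugacy classes and the Moebius function\<close>

definition conjugacy_classes :: "('a, 'b) monoid_scheme \<Rightarrow> 'a set set" where
  "conjugacy_classes G =
     orbits G (carrier G) (\<lambda>g. \<lambda>h\<in>carrier G. g \<otimes>\<^bsub>G\<^esub> h \<otimes>\<^bsub>G\<^esub> inv\<^bsub>G\<^esub> g)"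

definition moebius :: "nat \<Rightarrow> int" where
  "moebius n = (if squarefree n then (- 1) ^ card (prime_factors n) else 0)"

end

theory Submission
  imports Defs
begin

text \<open>The group is the semidirect product of \<open>\<int>/e\<close> by \<open>\<int>/d\<close>, the generator acting as
  multiplication by \<open>t\<close>. For \<open>y \<in> \<int>/e\<close> let \<open>f y\<close> be the length of its orbit under this action, so that
  \<open>t\<^sup>jy = y\<close> iff \<open>f y\<close> divides \<open>j\<close>; since \<open>e\<close> is squarefree, \<open>\<alpha> j = gcd (t\<^sup>j - 1, e)\<close> is the number
  of \<open>y\<close> with \<open>f y\<close> dividing \<open>j\<close>. All three quantities equal \<open>d * (\<Sum>y. 1 / (f y)\<^sup>2)\<close>: for the
  class number this is Burnside's count of commuting pairs, as \<open>(a, b)\<close> and \<open>(a', b')\<close> commute iff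
  \<open>b (t\<^sup>a\<^sup>' - 1) = b' (t\<^sup>a - 1)\<close> in \<open>\<int>/e\<close>; in the first sum the alternating inner sum counts the \<open>y\<close>
  with \<open>f y = k\<close> and \<open>f y\<close> dividing \<open>a\<close>; in the second it is Moebius inversion.\<close>

section \<open>Counting solutions of linear congruences\<close>

text \<open>Only the residue of \<open>t\<close> matters, so \<open>ord_divides\<close> can be
  applied to the natural number \<open>s\<close> in its place. If \<open>t\<close> is no unit modulo
  \<open>n\<close>, its \<open>ord\<close> is 0 by convention and both sides amount to
  \<open>k = 0\<close>.\<close>

lemma cong_power_eq_1_iff_ord_dvd_int:
  fixes t :: int
  assumes "n > 0"
  shows "[t ^ k = 1] (mod int n) \<longleftrightarrow> ord (int n) t dvd k"
proof -
  define s where "s = nat (t mod int n)"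
  have s: "int s = t mod int n"
    using assms by (simp add: s_def)
  have cong: "[t ^ i = 1] (mod int n) \<longleftrightarrow> [s ^ i = 1] (mod n)" for i
  proof -
    have "[int s ^ i = t ^ i] (mod int n)"
      by (intro cong_pow) (simp add: s cong_def)
    then have "[t ^ i = 1] (mod int n) \<longleftrightarrow> [int (s ^ i) = int 1] (mod int n)"
      by (simp add: cong_def)
    then show ?thesis
      by (simp only: cong_int_iff)
  qed
  have "coprime (int n) t \<longleftrightarrow> coprime (int n) (int s)"
    unfolding s by (metis coprime_commute coprime_mod_left_iff assms of_nat_0_less_iff order_less_irrefl)
  then have "ord (int n) t = ord n s"
    by (simp add: ord_def cong)
  then show ?thesis
    by (simp only: cong ord_divides)
qed

text \<open>With \<open>g = gcd u e\<close> and \<open>e = g * q\<close>, the cofactor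
  \<open>u div g\<close> is coprime to \<open>q\<close>, so the condition reduces to
  \<open>q dvd y\<close>, which has \<open>g\<close> solutions in the interval. For
  \<open>u = t ^ j - 1\<close> this counts the residues fixed by \<open>t ^ j\<close>.\<close>

lemma card_dvd_mult:
  fixes u :: int
  assumes "e > 0"
  shows "card {y \<in> {0..<int e}. int e dvd y * u} = nat (gcd u (int e))"
proof -
  define g where "g = gcd u (int e)"
  define q where "q = int e div g"
  have g: "g > 0" "int e = g * q"
    using assms by (auto simp: g_def q_def)
  then have q: "q > 0"
    using assms by (metis of_nat_0_less_iff zero_less_mult_pos)
  have "{y \<in> {0..<int e}. int e dvd y * u} = (\<lambda>i. q * i) ` {0..<g}"
  proof -
    have dvd: "int e dvd y * u \<longleftrightarrow> q dvd y" for y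
    proof -
      have "y * u = g * (y * (u div g))"
        by (simp add: g_def)
      then have "int e dvd y * u \<longleftrightarrow> g * q dvd g * (y * (u div g))"
        by (simp only: g(2))
      also have "\<dots> \<longleftrightarrow> q dvd y * (u div g)"
        using g by simp
      also have "\<dots> \<longleftrightarrow> q dvd y"
      proof (rule coprime_dvd_mult_left_iff)
        show "coprime q (u div g)"
          using assms unfolding q_def g_def
          by (metis coprime_commute div_gcd_coprime of_nat_0_less_iff order_less_irrefl)
      qed
      finally show ?thesis .
    qed
    show ?thesis
    proof (intro equalityI subsetI)
      fix y assume "y \<in> {y \<in> {0..<int e}. int e dvd y * u}"
      then have y: "0 \<le> y" "y < g * q" "q dvd y"
        using dvd g(2) by auto
      then obtain i where "y = q * i"
        by blast
      with y show "y \<in> (\<lambda>i. q * i) ` {0..<g}"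
        using q by (auto simp: zero_le_mult_iff mult.commute)
    next
      fix y assume "y \<in> (\<lambda>i. q * i) ` {0..<g}"
      then have "q dvd y" "0 \<le> y" "y < g * q"
        using q by (auto simp: mult.commute)
      then show "y \<in> {y \<in> {0..<int e}. int e dvd y * u}"
        using dvd g(2) by auto
    qed
  qed
  moreover have "inj_on (\<lambda>i. q * i) {0..<g}"
    using q by (simp add: inj_on_def)
  ultimately show ?thesis
    by (simp add: card_image g_def)
qed

text \<open>A unimodular change of variables turns \<open>b * u + c * v\<close> into \<open>b' * gcd u v\<close>.\<close>

lemma card_dvd_linear_form:
  fixes u v :: int
  assumes "e > 0"
  shows "card {(b, c) \<in> {0..<int e} \<times> {0..<int e}. int e dvd b * u + c * v}
    = e * card {y \<in> {0..<int e}. int e dvd y * u \<and> int e dvd y * v}"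
proof -
  define g where "g = gcd u v"
  have "\<exists>u' v' r s. u = g * u' \<and> v = g * v' \<and> r * u' + s * v' = 1"
  proof (cases "g = 0")
    case True
    \<comment> \<open>Here \<open>u = v = 0\<close>, so any coprime pair can serve as
      cofactors.\<close>
    then have "u = g * 1 \<and> v = g * 0 \<and> 1 * 1 + 0 * 0 = (1::int)"
      by (auto simp: g_def)
    then show ?thesis by blast
  next
    case False
    obtain u' v' where uv: "u = g * u'" "v = g * v'"
      unfolding g_def by (meson dvdE gcd_dvd1 gcd_dvd2)
    obtain r s where "r * u + s * v = g"
      unfolding g_def using bezout_int by blast
    then have "g * (r * u' + s * v') = g * 1"
      by (simp add: uv algebra_simps)
    then have "r * u' + s * v' = 1"
      using False by (simp only: mult_cancel_left) simp
    with uv show ?thesis by blast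
  qed
  then obtain u' v' r s where uv: "u = g * u'" "v = g * v'" and one: "r * u' + s * v' = 1"
    by blast
  define E where "E = int e"
  have E: "E > 0" using assms by (simp add: E_def)
  define S where "S = {y \<in> {0..<E}. E dvd y * g}"
  have S: "S = {y \<in> {0..<E}. E dvd y * u \<and> E dvd y * v}"
  proof -
    have "E dvd y * g \<longleftrightarrow> E dvd y * u \<and> E dvd y * v" for y
      using gcd_mult_left[of y u v] by (simp add: g_def flip: gcd_greatest_iff)
    then show ?thesis by (simp add: S_def)
  qed
  have form: "b * u + c * v = g * (b * u' + c * v')" for b c
    by (simp add: uv algebra_simps)
  \<comment> \<open>The matrix with rows \<open>(u', v')\<close> and \<open>(-s, r)\<close> has
    determinant \<open>r * u' + s * v' = 1\<close>; the witness \<open>f'\<close> below applies its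
    inverse. The first new coordinate carries the whole condition, the second is free and yields the
    factor \<open>e\<close>.\<close>
  have "bij_betw (\<lambda>(b, c). ((b * u' + c * v') mod E, (c * r - b * s) mod E))
      {(b, c) \<in> {0..<E} \<times> {0..<E}. E dvd b * u + c * v} (S \<times> {0..<E})"
  proof (rule bij_betw_byWitness[where f' = "\<lambda>(b, c). ((b * r - c * v') mod E, (b * s + c * u') mod E)"])
    have *: "((b * u' + c * v') mod E * r - (c * r - b * s) mod E * v') mod E = b mod E" for b c
    proof -
      have "((b * u' + c * v') mod E * r - (c * r - b * s) mod E * v') mod E =
          ((b * u' + c * v') * r - (c * r - b * s) * v') mod E"
        unfolding cong_def[symmetric]
        by (intro cong_diff cong_add cong_mult cong_refl) (simp_all add: cong_def)
      also have "(b * u' + c * v') * r - (c * r - b * s) * v' = b * (r * u' + s * v')"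
        by (simp add: algebra_simps)
      finally show ?thesis by (simp add: one)
    qed
    moreover have "((b * u' + c * v') mod E * s + (c * r - b * s) mod E * u') mod E = c mod E" for b c
    proof -
      have "((b * u' + c * v') mod E * s + (c * r - b * s) mod E * u') mod E =
          ((b * u' + c * v') * s + (c * r - b * s) * u') mod E"
        unfolding cong_def[symmetric]
        by (intro cong_diff cong_add cong_mult cong_refl) (simp_all add: cong_def)
      also have "(b * u' + c * v') * s + (c * r - b * s) * u' = c * (r * u' + s * v')"
        by (simp add: algebra_simps)
      finally show ?thesis by (simp add: one)
    qed
    ultimately show "\<forall>a\<in>{(b, c) \<in> {0..<E} \<times> {0..<E}. E dvd b * u + c * v}.
      (case case a of (b, c) \<Rightarrow> ((b * u' + c * v') mod E, (c * r - b * s) mod E) of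
        (b, c) \<Rightarrow> ((b * r - c * v') mod E, (b * s + c * u') mod E)) = a"
      by auto
    have *: "((b * r - c * v') mod E * u' + (b * s + c * u') mod E * v') mod E = b mod E" for b c
    proof -
      have "((b * r - c * v') mod E * u' + (b * s + c * u') mod E * v') mod E =
          ((b * r - c * v') * u' + (b * s + c * u') * v') mod E"
        unfolding cong_def[symmetric]
        by (intro cong_diff cong_add cong_mult cong_refl) (simp_all add: cong_def)
      also have "(b * r - c * v') * u' + (b * s + c * u') * v' = b * (r * u' + s * v')"
        by (simp add: algebra_simps)
      finally show ?thesis by (simp add: one)
    qed
    moreover have "((b * s + c * u') mod E * r - (b * r - c * v') mod E * s) mod E = c mod E" for b c
    proof -
      have "((b * s + c * u') mod E * r - (b * r - c * v') mod E * s) mod E =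
          ((b * s + c * u') * r - (b * r - c * v') * s) mod E"
        unfolding cong_def[symmetric]
        by (intro cong_diff cong_add cong_mult cong_refl) (simp_all add: cong_def)
      also have "(b * s + c * u') * r - (b * r - c * v') * s = c * (r * u' + s * v')"
        by (simp add: algebra_simps)
      finally show ?thesis by (simp add: one)
    qed
    ultimately show "\<forall>a\<in>S \<times> {0..<E}.
      (case case a of (b, c) \<Rightarrow> ((b * r - c * v') mod E, (b * s + c * u') mod E) of
        (b, c) \<Rightarrow> ((b * u' + c * v') mod E, (c * r - b * s) mod E)) = a"
      by (auto simp: S_def)
    have dvd_mod: "E dvd (x mod E) * g \<longleftrightarrow> E dvd g * x" for x
      by (simp add: dvd_eq_mod_eq_0 mod_simps mult.commute)
    show "(\<lambda>(b, c). ((b * u' + c * v') mod E, (c * r - b * s) mod E)) `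
      {(b, c) \<in> {0..<E} \<times> {0..<E}. E dvd b * u + c * v} \<subseteq> S \<times> {0..<E}"
      using E by (auto simp: S_def dvd_mod form)
    show "(\<lambda>(b, c). ((b * r - c * v') mod E, (b * s + c * u') mod E)) ` (S \<times> {0..<E})
      \<subseteq> {(b, c) \<in> {0..<E} \<times> {0..<E}. E dvd b * u + c * v}"
    proof -
      have "E dvd (b * r - c * v') mod E * u + (b * s + c * u') mod E * v" if "E dvd b * g" for b c
      proof -
        have "((b * r - c * v') mod E * u + (b * s + c * u') mod E * v) mod E =
            g * (((b * r - c * v') mod E * u' + (b * s + c * u') mod E * v') mod E) mod E"
          by (simp only: form mod_mult_right_eq)
        also have "\<dots> = 0"
          using that by (simp only: * mod_mult_right_eq) (simp add: mult.commute)
        finally show ?thesis by (simp add: dvd_eq_mod_eq_0)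
      qed
      then show ?thesis
        using E by (auto simp: S_def)
    qed
  qed
  then have "card {(b, c) \<in> {0..<E} \<times> {0..<E}. E dvd b * u + c * v} = card S * e"
    by (auto dest!: bij_betw_same_card simp: card_cartesian_product E_def)
  then show ?thesis
    by (simp add: S E_def mult.commute)
qed

section \<open>Greatest common divisors with products of primes, and multiples in intervals\<close>

lemma gcd_mult_left_coprime:
  fixes a b c :: nat
  assumes "coprime a b"
  shows "gcd (a * b) c = gcd a c * gcd b c"
proof (rule dvd_antisym)
  have "coprime (gcd a c) (gcd b c)"
    using assms by (meson coprime_divisors gcd_dvd1)
  then show "gcd a c * gcd b c dvd gcd (a * b) c"
    by (simp add: mult_dvd_mono divides_mult)
  show "gcd (a * b) c dvd gcd a c * gcd b c"
  proof -
    \<comment> \<open>Every one of the four products is a multiple of \<open>a * b\<close> or of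
      \<open>c\<close>, hence of \<open>gcd (a * b) c\<close>.\<close>
    have "gcd a c * gcd b c = gcd (gcd (a * b) (c * b)) (gcd (a * c) (c * c))"
      by (simp add: gcd_mult_distrib_nat mult.commute)
    then show ?thesis
      by (simp add: dvd_mult dvd_mult2)
  qed
qed

text \<open>Pairwise coprimality lets the gcd be taken factor by factor, and a prime contributes
  itself or 1. This turns the product defining \<open>\<alpha> j\<close> into the gcd of
  \<open>e\<close> and \<open>t ^ j - 1\<close>.\<close>

lemma gcd_prod_distinct_primes:
  fixes p :: "'a \<Rightarrow> nat"
  assumes "finite A" "\<And>i. i \<in> A \<Longrightarrow> prime (p i)" "inj_on p A"
  shows "gcd (\<Prod>i\<in>A. p i) c = (\<Prod>i\<in>{i \<in> A. p i dvd c}. p i)"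
  using assms
proof (induction A rule: finite_induct)
  case (insert x A)
  have "coprime (p x) (p i)" if "i \<in> A" for i
    using that insert.prems insert.hyps by (intro primes_coprime) (auto simp: inj_on_def)
  then have "coprime (p x) (\<Prod>i\<in>A. p i)"
    by (rule prod_coprime_right)
  then have "gcd (\<Prod>i\<in>insert x A. p i) c = gcd (p x) c * gcd (\<Prod>i\<in>A. p i) c"
    using insert.hyps by (simp add: gcd_mult_left_coprime)
  moreover have "gcd (p x) c = (if p x dvd c then p x else 1)"
    using insert.prems by (auto simp: gcd_nat.absorb1 prime_imp_coprime)
  moreover have "{i \<in> insert x A. p i dvd c} =
      (if p x dvd c then insert x {i \<in> A. p i dvd c} else {i \<in> A. p i dvd c})"
    by auto
  ultimately show ?case
    using insert by auto
qed simp

text \<open>The theorem sums over \<open>{1..d}\<close>, whereas exponents in the group range over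
  \<open>{..<d}\<close>; hence this count and its companion below.\<close>

lemma card_multiples_atLeastAtMost:
  fixes k :: nat
  assumes "k dvd d"
  shows "card {a \<in> {1..d}. k dvd a} = d div k"
proof (cases "k = 0")
  case False
  then have "{a \<in> {1..d}. k dvd a} = (\<lambda>i. k * i) ` {1..d div k}"
    using assms by (auto simp: image_iff elim!: dvdE)
  moreover have "inj_on (\<lambda>i. k * i) {1..d div k}"
    using False by (simp add: inj_on_def)
  ultimately show ?thesis
    by (simp add: card_image)
qed (use assms in auto)

lemma card_multiples_lessThan:
  fixes k :: nat
  assumes "k dvd d"
  shows "card {a \<in> {..<d}. k dvd a} = d div k"
proof (cases "k = 0")
  case False
  then have "{a \<in> {..<d}. k dvd a} = (\<lambda>i. k * i) ` {..<d div k}"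
    using assms by (auto simp: image_iff elim!: dvdE)
  moreover have "inj_on (\<lambda>i. k * i) {..<d div k}"
    using False by (simp add: inj_on_def)
  ultimately show ?thesis
    by (simp add: card_image)
qed (use assms in auto)

section \<open>Inclusion-exclusion and Moebius sums\<close>

declare sum_of_bool_eq [simp del] sum_of_bool_mult_eq [simp del] sum_mult_of_bool_eq [simp del]

text \<open>This is the expansion of the product of \<open>1 - of_bool (P s)\<close> over
  \<open>A\<close>.\<close>

lemma sum_Pow_alternating_Ball:
  fixes A :: "'a set"
  assumes "finite A"
  shows "(\<Sum>S\<in>Pow A. (- 1) ^ card S * of_bool (\<forall>s\<in>S. P s)) = (of_bool (\<forall>s\<in>A. \<not> P s) :: 'b :: comm_ring_1)"
proof -
  have bool_prod: "(\<Prod>s\<in>S. of_bool (Q s)) = (of_bool (\<forall>s\<in>S. Q s) :: 'b)" if "finite S" for S :: "'a set" and Q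
    using that by (induction S rule: finite_induct) (auto simp: of_bool_conj)
  \<comment> \<open>The trivial product over \<open>A - S\<close> gives the summand the shape that
    \<open>prod_diff_conv_sum\<close> expects.\<close>
  have "(\<Sum>S\<in>Pow A. (- 1) ^ card S * of_bool (\<forall>s\<in>S. P s)) =
      (\<Sum>S\<in>Pow A. (- 1) ^ card S * (\<Prod>s\<in>S. of_bool (P s)) * (\<Prod>s\<in>A - S. 1 :: 'b))"
    using assms by (intro sum.cong HOL.refl) (auto simp: bool_prod finite_subset)
  also have "\<dots> = (\<Prod>s\<in>A. 1 - of_bool (P s))"
    using assms by (simp only: prod_diff_conv_sum)
  also have "\<dots> = (\<Prod>s\<in>A. of_bool (\<not> P s))"
    by (intro prod.cong) auto
  finally show ?thesis
    using assms by (simp add: bool_prod)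
qed

text \<open>A strictly increasing list is determined by its set of entries, so the lists of length
  \<open>l\<close> stand for the \<open>l\<close>-element subsets. Since
  \<open>card A \<le> n\<close>, the lengths up to \<open>n\<close> reach every subset.\<close>

lemma sum_strict_sorted_lists:
  fixes f :: "nat set \<Rightarrow> 'b :: comm_semiring_1" and c :: "nat \<Rightarrow> 'b"
  assumes "finite A" "card A \<le> n"
  shows "(\<Sum>l = 0..n. c l * (\<Sum>js \<in> {js. length js = l \<and> sorted_wrt (<) js \<and> set js \<subseteq> A}. f (set js)))
    = (\<Sum>S\<in>Pow A. c (card S) * f S)"
proof -
  have "(\<Sum>l = 0..n. c l * (\<Sum>js \<in> {js. length js = l \<and> sorted_wrt (<) js \<and> set js \<subseteq> A}. f (set js)))
    = (\<Sum>l = 0..n. \<Sum>S\<in>{S \<in> Pow A. card S = l}. c (card S) * f S)"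
  proof (rule sum.cong[OF HOL.refl])
    fix l
    have "bij_betw set {js. length js = l \<and> sorted_wrt (<) js \<and> set js \<subseteq> A} {S \<in> Pow A. card S = l}"
      unfolding bij_betw_def
    proof
      show "inj_on set {js. length js = l \<and> sorted_wrt (<) js \<and> set js \<subseteq> A}"
        by (auto simp: inj_on_def intro: strict_sorted_equal)
      show "set ` {js. length js = l \<and> sorted_wrt (<) js \<and> set js \<subseteq> A} = {S \<in> Pow A. card S = l}"
      proof (intro equalityI subsetI)
        fix S assume S: "S \<in> {S \<in> Pow A. card S = l}"
        then have "finite S"
          using assms finite_subset by auto
        with S show "S \<in> set ` {js. length js = l \<and> sorted_wrt (<) js \<and> set js \<subseteq> A}"
          by (auto intro!: image_eqI[where x = "sorted_list_of_set S"])
      qed (auto simp: strict_sorted_iff distinct_card)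
    qed
    then have "(\<Sum>js \<in> {js. length js = l \<and> sorted_wrt (<) js \<and> set js \<subseteq> A}. f (set js))
      = (\<Sum>S\<in>{S \<in> Pow A. card S = l}. f S)"
      by (rule sum.reindex_bij_betw)
    then show "c l * (\<Sum>js \<in> {js. length js = l \<and> sorted_wrt (<) js \<and> set js \<subseteq> A}. f (set js))
      = (\<Sum>S\<in>{S \<in> Pow A. card S = l}. c (card S) * f S)"
      by (simp add: sum_distrib_left)
  qed
  also have "\<dots> = (\<Sum>S\<in>Pow A. c (card S) * f S)"
    using assms by (intro sum.group) (auto intro: order.trans[OF card_mono])
  finally show ?thesis .
qed

lemma real_card_eq_sum_of_bool:
  "finite A \<Longrightarrow> real (card {x \<in> A. P x}) = (\<Sum>x\<in>A. of_bool (P x))"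
  by (simp add: of_bool_def sum.If_cases Int_def)

lemma sum_of_bool_multiples:
  fixes k :: nat
  assumes "k dvd d"
  shows "(\<Sum>a = 1..d. of_bool (k dvd a)) = real (d div k)"
    and "(\<Sum>a<d. of_bool (k dvd a)) = real (d div k)"
  using card_multiples_atLeastAtMost[OF assms] card_multiples_lessThan[OF assms]
    real_card_eq_sum_of_bool[of "{1..d}" "\<lambda>a. k dvd a"]
    real_card_eq_sum_of_bool[of "{..<d}" "\<lambda>a. k dvd a"]
  by simp_all

text \<open>The alternating sum over \<open>S\<close> removes every \<open>y\<close> for which \<open>f y\<close> divides some positive integer
  below \<open>k\<close>; as \<open>f y\<close> divides \<open>k\<close>, this leaves \<open>f y = k\<close>.\<close>

lemma inclusion_exclusion_Gcd:
  fixes f :: "'a \<Rightarrow> nat"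
  assumes "finite U" "\<And>y. y \<in> U \<Longrightarrow> f y dvd d" "\<And>y. y \<in> U \<Longrightarrow> f y > 0" "k > 0"
  shows "(\<Sum>S\<in>Pow {1..<k}. (- 1) ^ card S * real (card {y \<in> U. f y dvd Gcd ({d, a, k} \<union> S)}))
    = (\<Sum>y\<in>U. of_bool (f y dvd a) * of_bool (f y = k))"
proof -
  have "(\<Sum>S\<in>Pow {1..<k}. (- 1) ^ card S * real (card {y \<in> U. f y dvd Gcd ({d, a, k} \<union> S)}))
    = (\<Sum>S\<in>Pow {1..<k}. \<Sum>y\<in>U. of_bool (f y dvd a \<and> f y dvd k) * ((- 1) ^ card S * of_bool (\<forall>s\<in>S. f y dvd s)))"
  proof (rule sum.cong[OF HOL.refl])
    fix S
    have "real (card {y \<in> U. f y dvd Gcd ({d, a, k} \<union> S)})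
      = (\<Sum>y\<in>U. of_bool (f y dvd Gcd ({d, a, k} \<union> S)))"
      using assms(1) by (rule real_card_eq_sum_of_bool)
    \<comment> \<open>The entry \<open>d\<close> of the gcd imposes no condition because
      \<open>f y dvd d\<close>.\<close>
    also have "\<dots> = (\<Sum>y\<in>U. of_bool (f y dvd a \<and> f y dvd k) * of_bool (\<forall>s\<in>S. f y dvd s))"
      using assms(2) by (intro sum.cong HOL.refl) (auto simp: dvd_Gcd_iff)
    finally show "(- 1) ^ card S * real (card {y \<in> U. f y dvd Gcd ({d, a, k} \<union> S)})
      = (\<Sum>y\<in>U. of_bool (f y dvd a \<and> f y dvd k) * ((- 1) ^ card S * of_bool (\<forall>s\<in>S. f y dvd s)))"
      by (simp add: sum_distrib_left algebra_simps)
  qed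
  also have "\<dots> = (\<Sum>y\<in>U. of_bool (f y dvd a \<and> f y dvd k) *
      (\<Sum>S\<in>Pow {1..<k}. (- 1) ^ card S * of_bool (\<forall>s\<in>S. f y dvd s)))"
    by (subst sum.swap) (simp add: sum_distrib_left)
  also have "\<dots> = (\<Sum>y\<in>U. of_bool (f y dvd a \<and> f y dvd k) * of_bool (\<forall>s\<in>{1..<k}. \<not> f y dvd s))"
    by (subst sum_Pow_alternating_Ball) simp_all
  also have "\<dots> = (\<Sum>y\<in>U. of_bool (f y dvd a) * of_bool (f y = k))"
  proof (rule sum.cong[OF HOL.refl])
    fix y assume "y \<in> U"
    then have "f y > 0" by (rule assms(3))
    have "f y dvd k \<and> (\<forall>s\<in>{1..<k}. \<not> f y dvd s) \<longleftrightarrow> f y = k"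
    proof
      assume *: "f y dvd k \<and> (\<forall>s\<in>{1..<k}. \<not> f y dvd s)"
      then have "f y \<le> k" using \<open>k > 0\<close> by (simp add: dvd_imp_le)
      \<comment> \<open>Otherwise \<open>f y\<close> itself would be one of the excluded
        \<open>s\<close>, as it divides itself.\<close>
      moreover have "f y \<notin> {1..<k}" using *[THEN conjunct2] dvd_refl[of "f y"] by blast
      ultimately show "f y = k" using \<open>f y > 0\<close> by simp
    qed (auto dest: nat_dvd_not_less)
    then show "of_bool (f y dvd a \<and> f y dvd k) * of_bool (\<forall>s\<in>{1..<k}. \<not> f y dvd s)
      = (of_bool (f y dvd a) * of_bool (f y = k) :: real)"
      by auto
  qed
  finally show ?thesis .
qed

text \<open>Each \<open>y\<close> survives only at \<open>k = f y\<close>, with weight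
  \<open>1 / f y\<close>, and there for the \<open>d div f y\<close> multiples \<open>a\<close> of
  \<open>f y\<close>. Its total contribution is therefore \<open>d / (f y)\<^sup>2\<close>.\<close>

lemma sum_inclusion_exclusion_Gcd:
  fixes f :: "'a \<Rightarrow> nat"
  assumes "finite U" "\<And>y. y \<in> U \<Longrightarrow> f y dvd d" "d > 0"
  shows "(\<Sum>k = 1..d. \<Sum>a = 1..d. 1 / real k *
      (\<Sum>S\<in>Pow {1..<k}. (- 1) ^ card S * real (card {y \<in> U. f y dvd Gcd ({d, a, k} \<union> S)})))
    = real d * (\<Sum>y\<in>U. 1 / real (f y) ^ 2)"
proof -
  have pos: "f y > 0" if "y \<in> U" for y
    using assms(2)[OF that] assms(3) by (auto intro: Nat.gr0I)
  have "(\<Sum>k = 1..d. \<Sum>a = 1..d. 1 / real k *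
      (\<Sum>S\<in>Pow {1..<k}. (- 1) ^ card S * real (card {y \<in> U. f y dvd Gcd ({d, a, k} \<union> S)})))
    = (\<Sum>k = 1..d. \<Sum>a = 1..d. \<Sum>y\<in>U. of_bool (f y dvd a) * (of_bool (f y = k) / real k))"
    by (intro sum.cong HOL.refl, subst inclusion_exclusion_Gcd)
       (use assms pos in \<open>auto simp: sum_distrib_left\<close>)
  also have "\<dots> = (\<Sum>k = 1..d. \<Sum>y\<in>U. \<Sum>a = 1..d. of_bool (f y dvd a) * (of_bool (f y = k) / real k))"
    by (intro sum.cong HOL.refl sum.swap)
  also have "\<dots> = (\<Sum>y\<in>U. \<Sum>k = 1..d. \<Sum>a = 1..d. of_bool (f y dvd a) * (of_bool (f y = k) / real k))"
    by (rule sum.swap)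
  also have "\<dots> = (\<Sum>y\<in>U. real d * (1 / real (f y) ^ 2))"
  proof (rule sum.cong[OF HOL.refl])
    fix y assume y: "y \<in> U"
    have "(\<Sum>a = 1..d. of_bool (f y dvd a)) = real (d div f y)"
      using assms(2)[OF y] by (rule sum_of_bool_multiples)
    then have "(\<Sum>k = 1..d. \<Sum>a = 1..d. of_bool (f y dvd a) * (of_bool (f y = k) / real k))
      = (\<Sum>k = 1..d. real (d div f y) * (of_bool (f y = k) / real k))"
      by (simp only: sum_distrib_right[symmetric])
    also have "\<dots> = (\<Sum>k = 1..d. if f y = k then real (d div f y) / real k else 0)"
      by (intro sum.cong) auto
    also have "\<dots> = real (d div f y) / real (f y)"
      using y assms pos by (auto simp: dvd_imp_le Suc_le_eq)
    also have "\<dots> = real d * (1 / real (f y) ^ 2)"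
      using assms(2)[OF y] by (simp add: real_of_nat_div power2_eq_square)
    finally show "(\<Sum>k = 1..d. \<Sum>a = 1..d. of_bool (f y dvd a) * (of_bool (f y = k) / real k))
      = real d * (1 / real (f y) ^ 2)" .
  qed
  finally show ?thesis by (simp add: sum_distrib_left)
qed

text \<open>Each \<open>y\<close> is counted once for every pair of multiples of \<open>f y\<close>
  below \<open>d\<close>, that is \<open>(d / f y)\<^sup>2\<close> times.\<close>

lemma sum_card_common_multiples:
  fixes f :: "'a \<Rightarrow> nat"
  assumes "finite U" "\<And>y. y \<in> U \<Longrightarrow> f y dvd d"
  shows "(\<Sum>a<d. \<Sum>b<d. real (card {y \<in> U. f y dvd a \<and> f y dvd b}))
    = real d ^ 2 * (\<Sum>y\<in>U. 1 / real (f y) ^ 2)"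
proof -
  have "(\<Sum>a<d. \<Sum>b<d. real (card {y \<in> U. f y dvd a \<and> f y dvd b}))
    = (\<Sum>a<d. \<Sum>b<d. \<Sum>y\<in>U. of_bool (f y dvd a) * of_bool (f y dvd b))"
    using assms by (simp add: real_card_eq_sum_of_bool of_bool_conj)
  also have "\<dots> = (\<Sum>a<d. \<Sum>y\<in>U. \<Sum>b<d. of_bool (f y dvd a) * of_bool (f y dvd b))"
    by (intro sum.cong HOL.refl sum.swap)
  also have "\<dots> = (\<Sum>y\<in>U. \<Sum>a<d. \<Sum>b<d. of_bool (f y dvd a) * of_bool (f y dvd b))"
    by (rule sum.swap)
  also have "\<dots> = (\<Sum>y\<in>U. (\<Sum>a<d. of_bool (f y dvd a)) * (\<Sum>b<d. of_bool (f y dvd b)))"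
    by (simp add: sum_product)
  also have "\<dots> = (\<Sum>y\<in>U. real d ^ 2 * (1 / real (f y) ^ 2))"
    using assms(2)
    by (intro sum.cong HOL.refl)
       (simp add: sum_of_bool_multiples real_of_nat_div power2_eq_square)
  finally show ?thesis by (simp add: sum_distrib_left)
qed

section \<open>Sums of the Moebius function over divisors\<close>

lemma prime_factors_prod_primes:
  fixes S :: "nat set"
  assumes "finite S" "\<And>p. p \<in> S \<Longrightarrow> prime p"
  shows "prime_factors (\<Prod>S) = S"
  using assms
proof (induction S rule: finite_induct)
  case (insert x S)
  have "0 \<notin> S" using insert.prems by (metis insertCI not_prime_0)
  then have "\<Prod>S \<noteq> 0" using insert by simp
  moreover have "prime x" using insert by auto
  ultimately show ?case
    using insert by (simp add: prime_factors_product prime_prime_factors prime_gt_0_nat)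
qed simp

text \<open>Only squarefree divisors contribute, and these are the products of subsets of
  \<open>prime_factors n\<close>. What remains is the alternating sum over all subsets, which
  vanishes unless \<open>n\<close> has no prime factor.\<close>

lemma sum_moebius_divisors:
  assumes "n > 0"
  shows "(\<Sum>s | s dvd n. moebius s) = of_bool (n = 1)"
proof -
  have fin: "finite (prime_factors n)" by simp
  have "bij_betw \<Prod> (Pow (prime_factors n)) {s. s dvd n \<and> squarefree s}"
    unfolding bij_betw_def
  proof
    have pf: "prime_factors (\<Prod>S) = S" if "S \<subseteq> prime_factors n" for S
      using that finite_subset[OF that] by (intro prime_factors_prod_primes) auto
    then show "inj_on \<Prod> (Pow (prime_factors n))"
      by (metis PowD inj_onI)
    show "\<Prod> ` Pow (prime_factors n) = {s. s dvd n \<and> squarefree s}"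
    proof (intro equalityI subsetI)
      fix s assume "s \<in> \<Prod> ` Pow (prime_factors n)"
      then obtain S where S: "S \<subseteq> prime_factors n" "s = \<Prod>S" by auto
      then have "s dvd (\<Prod>p\<in>S. p ^ multiplicity p n)"
        by (auto intro!: prod_dvd_prod dvd_power simp: prime_factors_multiplicity)
      also have "\<dots> dvd (\<Prod>p\<in>prime_factors n. p ^ multiplicity p n)"
        using S by (intro prod_dvd_prod_subset) auto
      also have "\<dots> = n"
        using assms by (simp add: prime_factorization_nat[symmetric])
      finally have "s dvd n" .
      moreover have "squarefree s"
        unfolding S(2) using S(1)
        by (intro squarefree_prod_coprime) (auto intro: primes_coprime squarefree_prime)
      ultimately show "s \<in> {s. s dvd n \<and> squarefree s}" by simp
    next
      fix s assume s: "s \<in> {s. s dvd n \<and> squarefree s}"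
      then have "s \<noteq> 0" using assms by auto
      then have "s = (\<Prod>p\<in>prime_factors s. p ^ multiplicity p s)"
        by (simp add: prime_factorization_nat[symmetric])
      also have "\<dots> = \<Prod>(prime_factors s)"
        using s \<open>s \<noteq> 0\<close> by (intro prod.cong) (auto simp: squarefree_factorial_semiring')
      finally show "s \<in> \<Prod> ` Pow (prime_factors n)"
        using s assms dvd_prime_factors[of n s] by blast
    qed
  qed
  then have "(\<Sum>s | s dvd n \<and> squarefree s. moebius s) = (\<Sum>S\<in>Pow (prime_factors n). moebius (\<Prod>S))"
    by (rule sum.reindex_bij_betw[symmetric])
  \<comment> \<open>The constant indicator prepares \<open>sum_Pow_alternating_Ball\<close> with a
    predicate that always holds.\<close>
  also have "\<dots> = (\<Sum>S\<in>Pow (prime_factors n). (- 1) ^ card S * of_bool (\<forall>s\<in>S. True))"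
  proof (rule sum.cong[OF HOL.refl])
    fix S assume S: "S \<in> Pow (prime_factors n)"
    then have "prime_factors (\<Prod>S) = S"
      using finite_subset[of S, OF _ fin] by (intro prime_factors_prod_primes) auto
    moreover have "squarefree (\<Prod>S)"
      using S by (intro squarefree_prod_coprime) (auto intro: primes_coprime squarefree_prime)
    ultimately show "moebius (\<Prod>S) = (- 1) ^ card S * of_bool (\<forall>s\<in>S. True)"
      by (simp add: moebius_def)
  qed
  also have "\<dots> = of_bool (prime_factors n = {})"
    by (subst sum_Pow_alternating_Ball) auto
  also have "prime_factors n = {} \<longleftrightarrow> n = 1"
    using assms by (auto simp: prime_factorization_empty_iff)
  finally have "(\<Sum>s | s dvd n \<and> squarefree s. moebius s) = of_bool (n = 1)" .
  moreover have "(\<Sum>s | s dvd n. moebius s) = (\<Sum>s | s dvd n \<and> squarefree s. moebius s)"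
    using assms by (intro sum.mono_neutral_right) (auto simp: moebius_def)
  ultimately show ?thesis by simp
qed

text \<open>Put \<open>r = j * s\<close>. The pairs become those with \<open>r dvd d\<close>,
  \<open>k dvd r\<close> and \<open>s dvd r div k\<close>, while the denominator depends on
  \<open>r\<close> alone. The inner Moebius sum over \<open>s\<close> then leaves only
  \<open>r = k\<close>.\<close>

lemma sum_multiples_moebius:
  fixes k d :: nat
  assumes "k dvd d" "d > 0"
  shows "(\<Sum>j | j dvd d \<and> k dvd j. \<Sum>s | s dvd d div j. real_of_int (moebius s) / real (j * s) ^ 2)
    = 1 / real k ^ 2"
proof -
  have k: "k > 0" using assms by (auto intro: Nat.gr0I)
  have "(\<Sum>j | j dvd d \<and> k dvd j. \<Sum>s | s dvd d div j. real_of_int (moebius s) / real (j * s) ^ 2)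
    = (\<Sum>(j, s)\<in>Sigma {j. j dvd d \<and> k dvd j} (\<lambda>j. {s. s dvd d div j}). real_of_int (moebius s) / real (j * s) ^ 2)"
    using assms by (intro sum.Sigma) (auto intro!: finite_divisors_nat simp: dvd_div_eq_0_iff)
  also have "\<dots> = (\<Sum>(r, s)\<in>Sigma {r. r dvd d \<and> k dvd r} (\<lambda>r. {s. s dvd r div k}). real_of_int (moebius s) / real r ^ 2)"
  proof (rule sum.reindex_bij_witness[where i = "\<lambda>(r, s). (r div s, s)" and j = "\<lambda>(j, s). (j * s, s)"], goal_cases)
    case (1 x)
    then show ?case using assms by (auto elim!: dvdE)
  next
    case (2 x)
    then show ?case using assms k by (auto elim!: dvdE simp: mult_ac)
  next
    case (3 x)
    then show ?case using assms k by (auto elim!: dvdE)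
  next
    case (4 x)
    then show ?case using assms k by (auto elim!: dvdE)
  next
    case (5 x)
    then show ?case by auto
  qed
  also have "\<dots> = (\<Sum>r | r dvd d \<and> k dvd r. \<Sum>s | s dvd r div k. real_of_int (moebius s) / real r ^ 2)"
    using assms k by (intro sum.Sigma[symmetric]) (auto intro!: finite_divisors_nat elim!: dvdE)
  also have "\<dots> = (\<Sum>r | r dvd d \<and> k dvd r. if r = k then 1 / real k ^ 2 else 0)"
  proof (rule sum.cong[OF HOL.refl])
    fix r assume r: "r \<in> {r. r dvd d \<and> k dvd r}"
    then obtain q where q: "r = k * q" by auto
    then have "q > 0" using r assms by (auto intro: Nat.gr0I)
    have "(\<Sum>s | s dvd r div k. real_of_int (moebius s) / real r ^ 2)
      = real_of_int (\<Sum>s | s dvd q. moebius s) / real r ^ 2"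
      using k by (simp add: q sum_divide_distrib)
    also have "\<dots> = (if r = k then 1 / real k ^ 2 else 0)"
      using \<open>q > 0\<close> k by (simp add: sum_moebius_divisors q)
    finally show "(\<Sum>s | s dvd r div k. real_of_int (moebius s) / real r ^ 2)
      = (if r = k then 1 / real k ^ 2 else 0)" .
  qed
  also have "\<dots> = 1 / real k ^ 2"
    using assms by (subst sum.delta) auto
  finally show ?thesis .
qed

text \<open>Writing the cardinality as a sum over \<open>y\<close> and exchanging sums leaves, for
  each \<open>y\<close>, a sum over the multiples \<open>j\<close> of \<open>f y\<close>, which
  \<open>sum_multiples_moebius\<close> evaluates.\<close>

lemma sum_card_moebius:
  fixes f :: "'a \<Rightarrow> nat"
  assumes "finite U" "\<And>y. y \<in> U \<Longrightarrow> f y dvd d" "d > 0"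
  shows "(\<Sum>j \<in> {j. j dvd d}. real (card {y \<in> U. f y dvd j}) / real j ^ 2 *
      (\<Sum>s \<in> {s. s dvd d div j}. real_of_int (moebius s) / real s ^ 2))
    = (\<Sum>y\<in>U. 1 / real (f y) ^ 2)"
proof -
  define F where "F j = (\<Sum>s | s dvd d div j. real_of_int (moebius s) / real (j * s) ^ 2)" for j
  have "(\<Sum>j \<in> {j. j dvd d}. real (card {y \<in> U. f y dvd j}) / real j ^ 2 *
      (\<Sum>s \<in> {s. s dvd d div j}. real_of_int (moebius s) / real s ^ 2))
    = (\<Sum>j | j dvd d. \<Sum>y\<in>U. of_bool (f y dvd j) * F j)"
  proof (rule sum.cong[OF HOL.refl])
    fix j
    have "F j = (\<Sum>s | s dvd d div j. real_of_int (moebius s) / real s ^ 2) / real j ^ 2"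
      by (simp add: F_def sum_divide_distrib power_mult_distrib mult.commute)
    moreover have "(\<Sum>y\<in>U. of_bool (f y dvd j) * F j) = real (card {y \<in> U. f y dvd j}) * F j"
      using assms(1) by (simp only: real_card_eq_sum_of_bool sum_distrib_right)
    ultimately show "real (card {y \<in> U. f y dvd j}) / real j ^ 2 *
        (\<Sum>s \<in> {s. s dvd d div j}. real_of_int (moebius s) / real s ^ 2) = (\<Sum>y\<in>U. of_bool (f y dvd j) * F j)"
      by simp
  qed
  also have "\<dots> = (\<Sum>y\<in>U. \<Sum>j | j dvd d. of_bool (f y dvd j) * F j)"
    by (rule sum.swap)
  also have "\<dots> = (\<Sum>y\<in>U. \<Sum>j | j dvd d \<and> f y dvd j. F j)"
    using assms(3) by (intro sum.cong HOL.refl sum.mono_neutral_cong_right) auto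
  also have "\<dots> = (\<Sum>y\<in>U. 1 / real (f y) ^ 2)"
    using assms by (simp add: F_def sum_multiples_moebius del: of_nat_mult)
  finally show ?thesis .
qed

section \<open>Commuting pairs in the metacyclic group\<close>

text \<open>Burnside's lemma for the conjugation action, in which the fixed points of
  \<open>g\<close> form its centralizer.\<close>

lemma (in group) card_conjugacy_classes_mult_order:
  assumes "finite (carrier G)"
  shows "card (conjugacy_classes G) * order G
    = card {(g, h) \<in> carrier G \<times> carrier G. g \<otimes> h = h \<otimes> g}"
proof -
  interpret conj: group_action G "carrier G" "\<lambda>g. \<lambda>h\<in>carrier G. g \<otimes> h \<otimes> inv g"
    by (rule action_by_conjugation)
  have inv_eq: "invariants (carrier G) (\<lambda>g. \<lambda>h\<in>carrier G. g \<otimes> h \<otimes> inv g) g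
      = {h \<in> carrier G. g \<otimes> h = h \<otimes> g}" if g: "g \<in> carrier G" for g
  proof -
    have "g \<otimes> h \<otimes> inv g = h \<longleftrightarrow> g \<otimes> h = h \<otimes> g" if "h \<in> carrier G" for h
      using g that by (metis inv_closed inv_solve_right m_closed)
    then show ?thesis
      by (auto simp: invariants_def)
  qed
  have "card (conjugacy_classes G) * order G
    = (\<Sum>g\<in>carrier G. card {h \<in> carrier G. g \<otimes> h = h \<otimes> g})"
    unfolding conjugacy_classes_def
    using conj.burnside[OF assms assms] by (simp add: inv_eq)
  also have "\<dots> = card (Sigma (carrier G) (\<lambda>g. {h \<in> carrier G. g \<otimes> h = h \<otimes> g}))"
    using assms by simp
  also have "Sigma (carrier G) (\<lambda>g. {h \<in> carrier G. g \<otimes> h = h \<otimes> g})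
    = {(g, h) \<in> carrier G \<times> carrier G. g \<otimes> h = h \<otimes> g}"
    by auto
  finally show ?thesis .
qed

lemma finite_conjugacy_classes:
  "finite (carrier G) \<Longrightarrow> finite (conjugacy_classes G)"
  by (auto simp: conjugacy_classes_def orbits_def)

text \<open>Allows the commuting pairs of the presented group to be counted in a concrete
  model.\<close>

lemma card_commuting_pairs_iso:
  assumes "group G" "h \<in> iso G H"
  shows "card {(a, b) \<in> carrier G \<times> carrier G. a \<otimes>\<^bsub>G\<^esub> b = b \<otimes>\<^bsub>G\<^esub> a}
    = card {(a, b) \<in> carrier H \<times> carrier H. a \<otimes>\<^bsub>H\<^esub> b = b \<otimes>\<^bsub>H\<^esub> a}"
proof -
  interpret group G by fact
  have h: "bij_betw h (carrier G) (carrier H)"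
    and mult: "\<And>a b. a \<in> carrier G \<Longrightarrow> b \<in> carrier G \<Longrightarrow> h (a \<otimes>\<^bsub>G\<^esub> b) = h a \<otimes>\<^bsub>H\<^esub> h b"
    using assms(2) by (auto simp: iso_def hom_def)
  have comm: "h a \<otimes>\<^bsub>H\<^esub> h b = h b \<otimes>\<^bsub>H\<^esub> h a \<longleftrightarrow> a \<otimes>\<^bsub>G\<^esub> b = b \<otimes>\<^bsub>G\<^esub> a"
    if "a \<in> carrier G" "b \<in> carrier G" for a b
    using that h by (simp flip: mult) (metis bij_betw_imp_inj_on inj_on_eq_iff m_closed)
  have "bij_betw (map_prod h h) {(a, b) \<in> carrier G \<times> carrier G. a \<otimes>\<^bsub>G\<^esub> b = b \<otimes>\<^bsub>G\<^esub> a}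
      {(a, b) \<in> carrier H \<times> carrier H. a \<otimes>\<^bsub>H\<^esub> b = b \<otimes>\<^bsub>H\<^esub> a}"
    unfolding bij_betw_def
  proof
    show "inj_on (map_prod h h) {(a, b) \<in> carrier G \<times> carrier G. a \<otimes>\<^bsub>G\<^esub> b = b \<otimes>\<^bsub>G\<^esub> a}"
      using h by (auto simp: inj_on_def bij_betw_def)
    show "map_prod h h ` {(a, b) \<in> carrier G \<times> carrier G. a \<otimes>\<^bsub>G\<^esub> b = b \<otimes>\<^bsub>G\<^esub> a}
      = {(a, b) \<in> carrier H \<times> carrier H. a \<otimes>\<^bsub>H\<^esub> b = b \<otimes>\<^bsub>H\<^esub> a}"
      using comm bij_betw_imp_surj_on[OF h, symmetric] by (auto simp: image_iff)
  qed
  then show ?thesis by (rule bij_betw_same_card)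
qed

lemma (in group) word_val_word_pow:
  assumes "range f \<subseteq> carrier G"
  shows "word_val G f (word_pow [Gen x] k) = f x [^] k"
proof -
  have f: "f x \<in> carrier G" using assms by auto
  have comm: "z \<otimes> z [^] n = z [^] n \<otimes> z" if "z \<in> carrier G" for z and n :: nat
    using nat_pow_Suc2[OF that, of n] by simp
  have Gen: "word_val G f (concat (replicate n [Gen x])) = f x [^] n" for n
    using f by (induction n) (simp_all add: comm)
  have Inv: "word_val G f (concat (replicate n [Inv x])) = inv (f x) [^] n" for n
    using f by (induction n) (simp_all add: comm)
  show ?thesis
  proof (cases "k \<ge> 0")
    case True
    then show ?thesis
      by (simp only: word_pow_def if_True Gen pow_nat)
  next
    case False
    then obtain n where n: "k = - int n"
      by (metis int_cases2 of_nat_0_le_iff)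
    have "word_inv [Gen x] = [Inv x]"
      by (simp add: word_inv_def)
    then have "word_val G f (word_pow [Gen x] k) = inv (f x) [^] nat (- k)"
      using False by (simp only: word_pow_def if_False Inv)
    then show ?thesis
      using f by (simp add: n int_pow_neg_int nat_pow_inv)
  qed
qed

section \<open>A concrete model: the semidirect product\<close>

text \<open>The pair \<open>(a, b)\<close> stands for \<open>x\<^sup>a y\<^sup>b\<close>. Moving
  \<open>y\<^sup>b\<close> to the right past a power of \<open>x\<close> with exponent
  \<open>a'\<close> multiplies \<open>b\<close> by \<open>t ^ a'\<close>, whence the twist in the
  second component.\<close>

definition metacyclic_model :: "nat \<Rightarrow> nat \<Rightarrow> int \<Rightarrow> (nat \<times> int) monoid" where
  "metacyclic_model d e t =
     \<lparr>carrier = {..<d} \<times> {0..<int e},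
      mult = (\<lambda>(a, b) (a', b'). ((a + a') mod d, (b * t ^ a' + b') mod int e)),
      one = (0, 0)\<rparr>"

lemma metacyclic_model_simps [simp]:
  "carrier (metacyclic_model d e t) = {..<d} \<times> {0..<int e}"
  "(a, b) \<otimes>\<^bsub>metacyclic_model d e t\<^esub> (a', b') = ((a + a') mod d, (b * t ^ a' + b') mod int e)"
  "\<one>\<^bsub>metacyclic_model d e t\<^esub> = (0, 0)"
  by (simp_all add: metacyclic_model_def)

context
  fixes d e :: nat and t :: int
  assumes d: "d > 0" and e: "e > 0" and pow: "[t ^ d = 1] (mod int e)"
begin

text \<open>Makes the twist compatible with reducing exponents of \<open>x\<close> modulo
  \<open>d\<close>; associativity of the model rests on it.\<close>

lemma cong_power_mod: "[t ^ (a mod d) = t ^ a] (mod int e)"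
proof -
  have "t ^ a = (t ^ d) ^ (a div d) * t ^ (a mod d)"
    by (simp flip: power_mult power_add)
  moreover have "[(t ^ d) ^ (a div d) * t ^ (a mod d) = 1 ^ (a div d) * t ^ (a mod d)] (mod int e)"
    by (intro cong_mult cong_pow pow cong_refl)
  ultimately show ?thesis by (simp add: cong_sym_eq)
qed

lemma group_metacyclic_model: "group (metacyclic_model d e t)"
proof (rule groupI)
  fix x y assume "x \<in> carrier (metacyclic_model d e t)" "y \<in> carrier (metacyclic_model d e t)"
  then show "x \<otimes>\<^bsub>metacyclic_model d e t\<^esub> y \<in> carrier (metacyclic_model d e t)"
    using d e by auto
next
  show "\<one>\<^bsub>metacyclic_model d e t\<^esub> \<in> carrier (metacyclic_model d e t)"
    using d e by simp
next
  fix x y z :: "nat \<times> int"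
  obtain a b a' b' a'' b'' where x: "x = (a, b)" "y = (a', b')" "z = (a'', b'')"
    by (metis surj_pair)
  have "[(b * t ^ a' + b') mod int e * t ^ a'' + b'' = (b * t ^ a' + b') * t ^ a'' + b''] (mod int e)"
    by (intro cong_add cong_mult cong_refl) (simp add: cong_def)
  also have "(b * t ^ a' + b') * t ^ a'' + b'' = b * t ^ (a' + a'') + (b' * t ^ a'' + b'')"
    by (simp add: algebra_simps power_add)
  also have "[b * t ^ (a' + a'') + (b' * t ^ a'' + b'')
      = b * t ^ ((a' + a'') mod d) + (b' * t ^ a'' + b'') mod int e] (mod int e)"
    by (intro cong_add cong_mult cong_refl cong_sym[OF cong_power_mod]) (simp add: cong_def)
  finally show "x \<otimes>\<^bsub>metacyclic_model d e t\<^esub> y \<otimes>\<^bsub>metacyclic_model d e t\<^esub> z =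
      x \<otimes>\<^bsub>metacyclic_model d e t\<^esub> (y \<otimes>\<^bsub>metacyclic_model d e t\<^esub> z)"
    by (simp add: x cong_def mod_simps add.assoc)
next
  fix x assume "x \<in> carrier (metacyclic_model d e t)"
  then show "\<one>\<^bsub>metacyclic_model d e t\<^esub> \<otimes>\<^bsub>metacyclic_model d e t\<^esub> x = x"
    by auto
next
  fix x assume "x \<in> carrier (metacyclic_model d e t)"
  then obtain a b where x: "x = (a, b)" "a < d" by auto
  \<comment> \<open>The second entry solves \<open>b' * t ^ a + b = 0\<close> modulo
    \<open>e\<close>, because \<open>t ^ (d - a)\<close> inverts \<open>t ^ a\<close>. The outer
    \<open>mod d\<close> covers \<open>a = 0\<close>.\<close>
  define y where "y = ((d - a) mod d, (- b * t ^ (d - a)) mod int e)"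
  have "[(- b * t ^ (d - a)) mod int e * t ^ a + b = - b * t ^ (d - a) * t ^ a + b] (mod int e)"
    by (intro cong_add cong_mult cong_refl) (simp add: cong_def)
  also have "- b * t ^ (d - a) * t ^ a + b = - b * t ^ d + b"
    using x by (simp add: mult.assoc flip: power_add)
  also have "[- b * t ^ d + b = - b * 1 + b] (mod int e)"
    by (intro cong_add cong_mult cong_refl pow)
  finally have "y \<otimes>\<^bsub>metacyclic_model d e t\<^esub> x = \<one>\<^bsub>metacyclic_model d e t\<^esub>"
    using x by (simp add: y_def cong_def mod_simps)
  moreover have "y \<in> carrier (metacyclic_model d e t)"
    using d e by (simp add: y_def)
  ultimately show "\<exists>y\<in>carrier (metacyclic_model d e t).
      y \<otimes>\<^bsub>metacyclic_model d e t\<^esub> x = \<one>\<^bsub>metacyclic_model d e t\<^esub>"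
    by blast
qed

text \<open>The generators are written \<open>1 mod d\<close> and \<open>1 mod int e\<close> so that
  they stay in the carrier when \<open>d = 1\<close> or \<open>e = 1\<close>.\<close>

lemma metacyclic_model_pow_left:
  "(1 mod d, 0) [^]\<^bsub>metacyclic_model d e t\<^esub> (k :: nat) = (k mod d, 0)"
proof -
  interpret group "metacyclic_model d e t" by (rule group_metacyclic_model)
  show ?thesis by (induction k) (auto simp: mod_simps)
qed

lemma metacyclic_model_pow_right:
  "(0, 1 mod int e) [^]\<^bsub>metacyclic_model d e t\<^esub> (k :: nat) = (0, int k mod int e)"
proof -
  interpret group "metacyclic_model d e t" by (rule group_metacyclic_model)
  show ?thesis by (induction k) (auto simp: mod_simps algebra_simps)
qed

text \<open>Integer exponents occur because \<open>t\<close> may be negative in the relation for the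
  conjugate of \<open>y\<close>.\<close>

lemma metacyclic_model_int_pow_right:
  "(0, 1 mod int e) [^]\<^bsub>metacyclic_model d e t\<^esub> (k :: int) = (0, k mod int e)"
proof -
  interpret group "metacyclic_model d e t" by (rule group_metacyclic_model)
  have mem: "(0, 1 mod int e) \<in> carrier (metacyclic_model d e t)"
    using d e by simp
  show ?thesis
  proof (cases k)
    case (nonneg n)
    then show ?thesis by (simp add: int_pow_int metacyclic_model_pow_right)
  next
    case (neg n)
    have "inv\<^bsub>metacyclic_model d e t\<^esub> (0, int (Suc n) mod int e) = (0, - int (Suc n) mod int e)"
      using d e by (intro inv_equality) (auto simp: mod_simps)
    then show ?thesis
      using mem by (simp only: neg int_pow_neg_int metacyclic_model_pow_right)
  qed
qed

text \<open>Supplies the two hypotheses of \<open>presented_group_universal\<close>, and so a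
  homomorphism from the presented group to the model.\<close>

lemma metacyclic_model_relations:
  fixes f
  defines "f \<equiv> (\<lambda>g. case g of X \<Rightarrow> (1 mod d, 0) | Y \<Rightarrow> (0, 1 mod int e))"
  shows "range f \<subseteq> carrier (metacyclic_model d e t)"
    and "(r, s) \<in> metacyclic_relations d e t \<Longrightarrow>
      word_val (metacyclic_model d e t) f r = word_val (metacyclic_model d e t) f s"
proof -
  interpret group "metacyclic_model d e t" by (rule group_metacyclic_model)
  show f: "range f \<subseteq> carrier (metacyclic_model d e t)"
    using d e by (auto simp: f_def split: gen_xy.splits)
  note pow = word_val_word_pow[OF f]
  have fX: "f X = (1 mod d, 0)" and fY: "f Y = (0, 1 mod int e)"
    by (simp_all add: f_def)
  have mem: "f X \<in> carrier (metacyclic_model d e t)" "f Y \<in> carrier (metacyclic_model d e t)"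
    using f by auto
  \<comment> \<open>The conjugation relation is checked as \<open>x y\<^sup>t = y x\<close>, so that
    the inverse of \<open>x\<close> need not be computed.\<close>
  have "f X \<otimes>\<^bsub>metacyclic_model d e t\<^esub> (0, t mod int e) = f Y \<otimes>\<^bsub>metacyclic_model d e t\<^esub> f X"
  proof -
    have "[t ^ (1 mod d) = t ^ 1] (mod int e)"
      by (rule cong_power_mod)
    then have "[1 mod int e * t ^ (1 mod d) = 1 * t ^ 1] (mod int e)"
      by (intro cong_mult) (simp_all add: cong_def)
    then show ?thesis by (simp add: fX fY cong_def)
  qed
  then have conj: "inv\<^bsub>metacyclic_model d e t\<^esub> (f X) \<otimes>\<^bsub>metacyclic_model d e t\<^esub>
      (f Y \<otimes>\<^bsub>metacyclic_model d e t\<^esub> f X) = (0, t mod int e)"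
    using d e mem m_closed[OF mem(2,1)] by (intro inv_solve_left'[THEN iffD2]) simp_all
  assume "(r, s) \<in> metacyclic_relations d e t"
  then consider "r = word_pow [Gen X] (int d)" "s = []" | "r = word_pow [Gen Y] (int e)" "s = []"
    | "r = [Inv X, Gen Y, Gen X]" "s = word_pow [Gen Y] t"
    by (auto simp: metacyclic_relations_def)
  then show "word_val (metacyclic_model d e t) f r = word_val (metacyclic_model d e t) f s"
  proof cases
    case 1
    then show ?thesis
      by (simp only: pow fX int_pow_int metacyclic_model_pow_left word_val.simps) simp
  next
    case 2
    then show ?thesis
      by (simp only: pow fY int_pow_int metacyclic_model_pow_right word_val.simps) simp
  next
    case 3
    have "word_val (metacyclic_model d e t) f r = (0, t mod int e)"
      using conj mem by (simp only: 3 word_val.simps letter_val.simps r_one)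
    then show ?thesis by (simp only: 3 pow fY metacyclic_model_int_pow_right)
  qed
qed

end

section \<open>Normal form of words, and the isomorphism with the model\<close>

text \<open>The relation \<open>y x = x y\<^sup>t\<close> lets all powers of \<open>x\<close> be
  collected on the left. The resulting \<open>d * e\<close> normal forms bound the order of the
  presented group from above.\<close>

lemma (in group) metacyclic_normal_form:
  assumes x: "x \<in> carrier G" and y: "y \<in> carrier G"
    and pow: "x [^] (d::nat) = \<one>" "y [^] (e::nat) = \<one>"
    and conj: "inv x \<otimes> (y \<otimes> x) = y [^] (t::int)"
    and "d > 0" "e > 0"
    and f: "f X = x" "f Y = y"
  shows "word_val G f w \<in> (\<lambda>(a, b). x [^] a \<otimes> y [^] b) ` ({..<d} \<times> {..<e})"
proof -
  \<comment> \<open>A natural exponent with the same effect on \<open>y\<close>, so that the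
    rewriting stays within natural powers.\<close>
  define T where "T = nat (t mod int e)"
  have xmod: "x [^] a = x [^] (a mod d)" for a :: nat
  proof -
    have "x [^] a = x [^] (d * (a div d) + a mod d)" by simp
    also have "\<dots> = (x [^] d) [^] (a div d) \<otimes> x [^] (a mod d)"
      using x by (simp only: nat_pow_mult[symmetric] nat_pow_pow)
    finally show ?thesis using x by (simp add: pow)
  qed
  have ymod: "y [^] a = y [^] (a mod e)" for a :: nat
  proof -
    have "y [^] a = y [^] (e * (a div e) + a mod e)" by simp
    also have "\<dots> = (y [^] e) [^] (a div e) \<otimes> y [^] (a mod e)"
      using y by (simp only: nat_pow_mult[symmetric] nat_pow_pow)
    finally show ?thesis using y by (simp add: pow)
  qed
  have "y [^] t = y [^] T"
  proof -
    have "t = int e * (t div int e) + int T"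
      using \<open>e > 0\<close> by (simp add: T_def)
    then have "y [^] t = (y [^] int e) [^] (t div int e) \<otimes> y [^] int T"
      using y by (metis int_pow_mult int_pow_pow)
    then show ?thesis using y by (simp add: int_pow_int pow)
  qed
  then have yx: "y \<otimes> x = x \<otimes> y [^] T"
    using conj x y by (metis inv_solve_left m_closed nat_pow_closed)
  have yxa: "y [^] b \<otimes> x = x \<otimes> y [^] (b * T)" for b :: nat
  proof (induction b)
    case (Suc b)
    have "y [^] Suc b \<otimes> x = y [^] b \<otimes> (y \<otimes> x)"
      using x y by (simp add: m_assoc)
    also have "\<dots> = (y [^] b \<otimes> x) \<otimes> y [^] T"
      using x y by (simp add: yx m_assoc)
    also have "\<dots> = x \<otimes> y [^] (Suc b * T)"
      using x y by (simp add: Suc m_assoc nat_pow_mult add.commute)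
    finally show ?case .
  qed (use x y in simp)
  have yxab: "\<exists>c::nat. y [^] b \<otimes> x [^] a = x [^] a \<otimes> y [^] c" for a b :: nat
  proof (induction a arbitrary: b)
    case (Suc a)
    obtain c :: nat where c: "y [^] (b * T) \<otimes> x [^] a = x [^] a \<otimes> y [^] c"
      using Suc by blast
    have "y [^] b \<otimes> x [^] Suc a = (y [^] b \<otimes> x) \<otimes> x [^] a"
      using x y by (simp only: nat_pow_Suc2 m_assoc nat_pow_closed)
    also have "\<dots> = x \<otimes> (y [^] (b * T) \<otimes> x [^] a)"
      using x y by (simp add: yxa m_assoc)
    also have "\<dots> = x [^] Suc a \<otimes> y [^] c"
      using x y by (simp only: c nat_pow_Suc2 m_assoc nat_pow_closed)
    finally show ?case by blast
  qed (use x y in auto)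
  \<comment> \<open>Exponents are left unreduced while letters are multiplied on from the left; they
    are reduced modulo \<open>d\<close> and \<open>e\<close> only at the end.\<close>
  define N where "N = {x [^] a \<otimes> y [^] b | (a::nat) (b::nat). True}"
  have Nx: "x [^] k \<otimes> z \<in> N" if z: "z \<in> N" for z and k :: nat
  proof -
    obtain a b :: nat where "z = x [^] a \<otimes> y [^] b" using z by (auto simp: N_def)
    then have "x [^] k \<otimes> z = x [^] (k + a) \<otimes> y [^] b"
      using x y by (simp add: m_assoc flip: nat_pow_mult)
    then show ?thesis by (auto simp: N_def)
  qed
  have Ny: "y [^] k \<otimes> z \<in> N" if z: "z \<in> N" for z and k :: nat
  proof -
    obtain a b :: nat where z: "z = x [^] a \<otimes> y [^] b" using z by (auto simp: N_def)
    obtain c :: nat where c: "y [^] k \<otimes> x [^] a = x [^] a \<otimes> y [^] c" using yxab by blast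
    have "y [^] k \<otimes> z = (y [^] k \<otimes> x [^] a) \<otimes> y [^] b"
      using x y by (simp add: z m_assoc)
    also have "\<dots> = x [^] a \<otimes> y [^] (c + b)"
      using x y by (simp add: c m_assoc nat_pow_mult)
    finally show ?thesis by (auto simp: N_def)
  qed
  \<comment> \<open>Inverse letters thereby become natural powers, already covered by
    \<open>Nx\<close> and \<open>Ny\<close>.\<close>
  have invs: "inv x = x [^] (d - 1)" "inv y = y [^] (e - 1)"
    using x y pow \<open>d > 0\<close> \<open>e > 0\<close> by (auto intro!: inv_equality simp flip: nat_pow_Suc)
  have letter: "letter_val G f l \<otimes> z \<in> N" if z: "z \<in> N" for l z
  proof (cases l)
    case (Gen g)
    then show ?thesis
      using Nx[OF z, of 1] Ny[OF z, of 1] x y f by (cases g) simp_all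
  next
    case (Inv g)
    then show ?thesis
      using Nx[OF z, of "d - 1"] Ny[OF z, of "e - 1"] f invs by (cases g) simp_all
  qed
  have "word_val G f w \<in> N"
  proof (induction w)
    case Nil
    have "\<one> = x [^] (0::nat) \<otimes> y [^] (0::nat)" by simp
    then show ?case by (auto simp only: N_def word_val.simps)
  qed (use letter in simp)
  then obtain a b :: nat where "word_val G f w = x [^] a \<otimes> y [^] b"
    by (auto simp: N_def)
  then have "word_val G f w = x [^] (a mod d) \<otimes> y [^] (b mod e)"
    using xmod ymod by metis
  then show ?thesis
    using \<open>d > 0\<close> \<open>e > 0\<close> by (auto intro!: image_eqI[where x = "(a mod d, b mod e)"])
qed

text \<open>Every element of the presented group is thus the value of a word, so normal forms of
  values reach the whole carrier.\<close>

lemma word_val_presented_group: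
  "word_val (presented_group R) (\<lambda>g. word_class R [Gen g]) w = word_class R w"
proof (induction w)
  case (Cons l w)
  have "letter_val (presented_group R) (\<lambda>g. word_class R [Gen g]) l = word_class R [l]"
    by (cases l) (simp_all add: inv_presented_group word_inv_def)
  with Cons show ?case by simp
qed simp

text \<open>The universal property yields a homomorphism onto the model, which has
  \<open>d * e\<close> elements. The normal form allows the presented group no more than that, so
  the map is injective.\<close>

lemma metacyclic_group_iso_model:
  assumes d: "d > 0" and e: "e > 0" and pow: "[t ^ d = 1] (mod int e)"
  shows "\<exists>h. h \<in> iso (metacyclic_group d e t) (metacyclic_model d e t)"
proof -
  define R where "R = metacyclic_relations d e t"
  define M where "M = metacyclic_model d e t"
  define f where "f = (\<lambda>g. case g of X \<Rightarrow> (1 mod d, 0 :: int) | Y \<Rightarrow> (0, 1 mod int e))"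
  define P where "P = presented_group R"
  define x where "x = word_class R [Gen X]"
  define y where "y = word_class R [Gen Y]"
  interpret P: group P unfolding P_def by (rule group_presented_group)
  interpret M: group M unfolding M_def by (rule group_metacyclic_model[OF assms])
  have gens: "range (\<lambda>g. word_class R [Gen g]) \<subseteq> carrier P"
    by (auto simp: P_def)
  have xy: "x \<in> carrier P" "y \<in> carrier P"
    by (auto simp: P_def x_def y_def)
  have rel: "word_val P (\<lambda>g. word_class R [Gen g]) r = word_val P (\<lambda>g. word_class R [Gen g]) s"
    if "(r, s) \<in> R" for r s
    using presented_group_relation[OF that] by (simp add: P_def word_val_presented_group)
  note wp = P.word_val_word_pow[OF gens]
  have "x [^]\<^bsub>P\<^esub> int d = \<one>\<^bsub>P\<^esub>"
  proof -
    have "(word_pow [Gen X] (int d), []) \<in> R"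
      by (simp add: R_def metacyclic_relations_def)
    from rel[OF this] show ?thesis
      by (simp only: wp word_val.simps flip: x_def)
  qed
  moreover have "y [^]\<^bsub>P\<^esub> int e = \<one>\<^bsub>P\<^esub>"
  proof -
    have "(word_pow [Gen Y] (int e), []) \<in> R"
      by (simp add: R_def metacyclic_relations_def)
    from rel[OF this] show ?thesis
      by (simp only: wp word_val.simps flip: y_def)
  qed
  moreover have "inv\<^bsub>P\<^esub> x \<otimes>\<^bsub>P\<^esub> (y \<otimes>\<^bsub>P\<^esub> x) = y [^]\<^bsub>P\<^esub> t"
  proof -
    have "([Inv X, Gen Y, Gen X], word_pow [Gen Y] t) \<in> R"
      by (simp add: R_def metacyclic_relations_def)
    from rel[OF this] show ?thesis
      using xy by (simp only: wp word_val.simps letter_val.simps P.r_one flip: x_def y_def)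
  qed
  ultimately have nf: "word_val P (\<lambda>g. word_class R [Gen g]) w
      \<in> (\<lambda>(a, b). x [^]\<^bsub>P\<^esub> a \<otimes>\<^bsub>P\<^esub> y [^]\<^bsub>P\<^esub> b) ` ({..<d} \<times> {..<e})" for w
    using xy d e by (intro P.metacyclic_normal_form) (auto simp: int_pow_int x_def y_def)
  have sub: "carrier P \<subseteq> (\<lambda>(a, b). x [^]\<^bsub>P\<^esub> a \<otimes>\<^bsub>P\<^esub> y [^]\<^bsub>P\<^esub> b) ` ({..<d} \<times> {..<e})"
    using nf by (auto simp: P_def word_val_presented_group)
  then have fin: "finite (carrier P)"
    by (rule finite_subset) simp
  have card_le: "card (carrier P) \<le> d * e"
    using surj_card_le[OF _ sub] by (simp add: card_cartesian_product)
  obtain h where h: "h \<in> hom P M" "h x = f X" "h y = f Y"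
  proof -
    have "\<exists>h\<in>hom (presented_group R) M. \<forall>a. h (word_class R [Gen a]) = f a"
      using metacyclic_model_relations[OF assms]
      by (intro M.presented_group_universal) (simp_all only: M_def R_def f_def)
    then show thesis
      using that by (auto simp: P_def x_def y_def)
  qed
  interpret h: group_hom P M h
    using h by unfold_locales
  \<comment> \<open>The element \<open>(a, b)\<close> is the image of
    \<open>x\<^sup>a y\<^sup>b\<close>.\<close>
  have "carrier M \<subseteq> h ` carrier P"
  proof
    fix z assume "z \<in> carrier M"
    then obtain a b where z: "z = (a, int b)" "a < d" "b < e"
      by (auto simp: M_def elim!: nonneg_int_cases)
    have "h (x [^]\<^bsub>P\<^esub> a \<otimes>\<^bsub>P\<^esub> y [^]\<^bsub>P\<^esub> b) = f X [^]\<^bsub>M\<^esub> a \<otimes>\<^bsub>M\<^esub> f Y [^]\<^bsub>M\<^esub> b"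
      using xy h by (simp add: h.hom_nat_pow)
    also have "\<dots> = (a mod d, 0) \<otimes>\<^bsub>M\<^esub> (0, int b mod int e)"
      by (simp only: f_def gen_xy.case M_def metacyclic_model_pow_left[OF assms]
          metacyclic_model_pow_right[OF assms])
    also have "\<dots> = z"
      using z by (simp add: M_def)
    finally show "z \<in> h ` carrier P"
      using xy by (metis P.m_closed P.nat_pow_closed imageI)
  qed
  then have surj: "h ` carrier P = carrier M"
    by auto
  moreover have "card (carrier M) = d * e"
    by (simp add: M_def card_cartesian_product)
  ultimately have "inj_on h (carrier P)"
    using fin card_le card_image_le[OF fin, of h] by (intro eq_card_imp_inj_on) auto
  then have "h \<in> iso P M"
    using h surj by (simp add: iso_def bij_betw_def)
  then show ?thesis
    by (auto simp: P_def M_def R_def metacyclic_group_def)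
qed

section \<open>Commuting pairs and the class number\<close>

text \<open>For fixed exponents \<open>a\<close> and \<open>a'\<close>, commuting is one linear
  congruence in \<open>(b, b')\<close>, whose solutions \<open>card_dvd_linear_form\<close>
  counts.\<close>

lemma card_commuting_pairs_metacyclic_model:
  assumes "e > 0"
  shows "card {(g, h) \<in> carrier (metacyclic_model d e t) \<times> carrier (metacyclic_model d e t).
      g \<otimes>\<^bsub>metacyclic_model d e t\<^esub> h = h \<otimes>\<^bsub>metacyclic_model d e t\<^esub> g}
    = e * (\<Sum>a<d. \<Sum>a'<d. card {y \<in> {0..<int e}.
        int e dvd y * (t ^ a - 1) \<and> int e dvd y * (t ^ a' - 1)})"
proof -
  define B where "B a a' = {(b, b') \<in> {0..<int e} \<times> {0..<int e}.
      int e dvd b * (t ^ a' - 1) + b' * - (t ^ a - 1)}" for a a'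
  have fin: "finite (B a a')" for a a'
    by (rule finite_subset[of _ "{0..<int e} \<times> {0..<int e}"]) (auto simp: B_def)
  have comm: "(b * t ^ a' + b') mod int e = (b' * t ^ a + b) mod int e \<longleftrightarrow>
      int e dvd b * (t ^ a' - 1) + b' * - (t ^ a - 1)" for a a' b b'
    by (simp add: mod_eq_dvd_iff algebra_simps)
  define C where "C = {(g, h) \<in> carrier (metacyclic_model d e t) \<times> carrier (metacyclic_model d e t).
      g \<otimes>\<^bsub>metacyclic_model d e t\<^esub> h = h \<otimes>\<^bsub>metacyclic_model d e t\<^esub> g}"
  have mem_C: "((a, b), (a', b')) \<in> C \<longleftrightarrow> a < d \<and> a' < d \<and> (b, b') \<in> B a a'" for a a' b b'
    by (auto simp: C_def B_def add.commute[of a a'] comm)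
  \<comment> \<open>Regroups each pair with the exponents first, so that the count fibres over
    \<open>(a, a')\<close>.\<close>
  have "C = (\<lambda>((a, a'), (b, b')). ((a, b), (a', b'))) ` Sigma ({..<d} \<times> {..<d}) (\<lambda>(a, a'). B a a')"
  proof (rule Set.set_eqI)
    fix z :: "(nat \<times> int) \<times> (nat \<times> int)"
    obtain a b a' b' where z: "z = ((a, b), (a', b'))"
      by (metis surj_pair)
    show "z \<in> C \<longleftrightarrow>
        z \<in> (\<lambda>((a, a'), (b, b')). ((a, b), (a', b'))) ` Sigma ({..<d} \<times> {..<d}) (\<lambda>(a, a'). B a a')"
      unfolding z mem_C by (auto intro!: image_eqI[where x = "((a, a'), (b, b'))"])
  qed
  moreover have "inj_on (\<lambda>((a, a'), (b, b')). ((a, b), (a', b')))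
      (Sigma ({..<d} \<times> {..<d}) (\<lambda>(a, a'). B a a'))"
    by (auto simp: inj_on_def)
  ultimately have "card C = card (Sigma ({..<d} \<times> {..<d}) (\<lambda>(a, a'). B a a'))"
    by (simp only: card_image)
  also have "\<dots> = (\<Sum>(a, a')\<in>{..<d} \<times> {..<d}. card (B a a'))"
    using fin by (subst card_SigmaI) (auto intro!: sum.cong)
  also have "\<dots> = (\<Sum>a<d. \<Sum>a'<d. card (B a a'))"
    by (rule sum.cartesian_product[symmetric])
  also have "\<dots> = (\<Sum>a<d. \<Sum>a'<d. e * card {y \<in> {0..<int e}.
        int e dvd y * (t ^ a - 1) \<and> int e dvd y * (t ^ a' - 1)})"
  proof -
    have "card (B a a') = e * card {y \<in> {0..<int e}.
        int e dvd y * (t ^ a - 1) \<and> int e dvd y * (t ^ a' - 1)}" for a a'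
      using card_dvd_linear_form[OF assms, of "t ^ a' - 1" "- (t ^ a - 1)"]
      by (simp only: B_def mult_minus_right dvd_minus_iff conj_commute)
    then show ?thesis by (simp only:)
  qed
  finally show ?thesis
    by (simp add: C_def sum_distrib_left)
qed

text \<open>Burnside's count gives \<open>d * e\<close> times the class number, and the commuting
  pairs carry a factor \<open>e\<close>, which is cancelled.\<close>

lemma card_conjugacy_classes_metacyclic_group:
  assumes d: "d > 0" and e: "e > 0" and pow: "[t ^ d = 1] (mod int e)"
  shows "finite (conjugacy_classes (metacyclic_group d e t))"
    and "d * card (conjugacy_classes (metacyclic_group d e t))
      = (\<Sum>a<d. \<Sum>a'<d. card {y \<in> {0..<int e}.
          int e dvd y * (t ^ a - 1) \<and> int e dvd y * (t ^ a' - 1)})"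
proof -
  obtain h where h: "h \<in> iso (metacyclic_group d e t) (metacyclic_model d e t)"
    using metacyclic_group_iso_model[OF assms] by blast
  interpret group "metacyclic_group d e t"
    unfolding metacyclic_group_def by (rule group_presented_group)
  have bij: "bij_betw h (carrier (metacyclic_group d e t)) ({..<d} \<times> {0..<int e})"
    using h by (simp add: iso_def)
  then have fin: "finite (carrier (metacyclic_group d e t))"
    using bij_betw_finite by blast
  then show "finite (conjugacy_classes (metacyclic_group d e t))"
    by (rule finite_conjugacy_classes)
  have "order (metacyclic_group d e t) = d * e"
    using bij_betw_same_card[OF bij] by (simp add: order_def card_cartesian_product)
  then have "e * (d * card (conjugacy_classes (metacyclic_group d e t))) =
    card (conjugacy_classes (metacyclic_group d e t)) * order (metacyclic_group d e t)"
    by simp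
  also have "\<dots> = e * (\<Sum>a<d. \<Sum>a'<d. card {y \<in> {0..<int e}.
          int e dvd y * (t ^ a - 1) \<and> int e dvd y * (t ^ a' - 1)})"
    unfolding card_conjugacy_classes_mult_order[OF fin]
      card_commuting_pairs_iso[OF group_axioms h] card_commuting_pairs_metacyclic_model[OF e] ..
  finally show "d * card (conjugacy_classes (metacyclic_group d e t))
      = (\<Sum>a<d. \<Sum>a'<d. card {y \<in> {0..<int e}.
          int e dvd y * (t ^ a - 1) \<and> int e dvd y * (t ^ a' - 1)})"
    using e by simp
qed

section \<open>Orbit lengths and the comparison of the three quantities\<close>

text \<open>Dividing \<open>y\<close> and \<open>e\<close> by their gcd leaves coprime cofactors, so
  \<open>t ^ j\<close> fixes \<open>y\<close> modulo \<open>e\<close> exactly when it is 1 modulo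
  the cofactor of \<open>e\<close>. The orbit length of \<open>y\<close> is the order of
  \<open>t\<close> for that modulus.\<close>

lemma dvd_mult_power_minus_1_iff_ord:
  fixes t y :: int
  assumes "e > 0"
  shows "int e dvd y * (t ^ j - 1) \<longleftrightarrow> ord (int (e div gcd (nat \<bar>y\<bar>) e)) t dvd j"
proof -
  define g where "g = gcd (nat \<bar>y\<bar>) e"
  define q where "q = e div g"
  have g: "int g = gcd y (int e)"
    by (simp only: g_def gcd_int_def abs_of_nat nat_int)
  have "g dvd e" unfolding g_def by (rule gcd_dvd2)
  then have e_eq: "e = g * q" by (simp add: q_def)
  then have "g > 0" "q > 0" using assms by (auto intro: Nat.gr0I)
  have "int g dvd y"
    unfolding g by (rule gcd_dvd1)
  then have "y * (t ^ j - 1) = int g * ((y div int g) * (t ^ j - 1))"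
    by (simp flip: mult.assoc)
  then have "int e dvd y * (t ^ j - 1) \<longleftrightarrow> int g * int q dvd int g * ((y div int g) * (t ^ j - 1))"
    by (simp only: e_eq of_nat_mult)
  also have "\<dots> \<longleftrightarrow> int q dvd (y div int g) * (t ^ j - 1)"
    using \<open>g > 0\<close> by simp
  also have "\<dots> \<longleftrightarrow> int q dvd t ^ j - 1"
  proof (rule coprime_dvd_mult_right_iff)
    have "coprime (y div int g) (int e div int g)"
      unfolding g using assms by (intro div_gcd_coprime) auto
    then show "coprime (int q) (y div int g)"
      by (simp add: q_def zdiv_int coprime_commute)
  qed
  also have "\<dots> \<longleftrightarrow> [t ^ j = 1] (mod int q)"
    by (simp add: cong_iff_dvd_diff)
  also have "\<dots> \<longleftrightarrow> ord (int q) t dvd j"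
    using \<open>q > 0\<close> by (rule cong_power_eq_1_iff_ord_dvd_int)
  finally show ?thesis by (simp add: q_def g_def)
qed

theorem theorem7:
  fixes n d e m :: nat and p ord_p \<alpha> :: "nat \<Rightarrow> nat" and t :: int
  assumes "n = d * e" and "d > 0" and "e > 0" and "squarefree n"
    and "\<And>i. i \<in> {1..m} \<Longrightarrow> prime (p i)" and "inj_on p {1..m}"
    and "e = (\<Prod>i = 1..m. p i)"
    and "ord (int e) t = d"
    and "\<And>i. i \<in> {1..m} \<Longrightarrow> ord_p i = ord (int (p i)) t"
    and "\<And>j. j > 0 \<Longrightarrow> \<alpha> j = (\<Prod>i \<in> {i \<in> {1..m}. ord_p i dvd j}. p i)"
  shows
    "finite (conjugacy_classes (metacyclic_group d e t)) \<and>
     real (card (conjugacy_classes (metacyclic_group d e t))) =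
       (\<Sum>k = 1..d. \<Sum>a = 1..d. 1 / real k *
          (\<Sum>l = 0..k - 1. (- 1) ^ l *
             (\<Sum>js \<in> {js. length js = l \<and> sorted_wrt (<) js \<and> set js \<subseteq> {1..<k}}.
                real (\<alpha> (Gcd ({d, a, k} \<union> set js)))))) \<and>
     (\<Sum>k = 1..d. \<Sum>a = 1..d. 1 / real k *
          (\<Sum>l = 0..k - 1. (- 1) ^ l *
             (\<Sum>js \<in> {js. length js = l \<and> sorted_wrt (<) js \<and> set js \<subseteq> {1..<k}}.
                real (\<alpha> (Gcd ({d, a, k} \<union> set js)))))) =
       real d * (\<Sum>j \<in> {j. j dvd d}. real (\<alpha> j) / real j ^ 2 *
          (\<Sum>s \<in> {s. s dvd d div j}. real_of_int (moebius s) / real s ^ 2))"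
proof -
  define f where "f y = ord (int (e div gcd (nat \<bar>y\<bar>) e)) t" for y :: int
  define U where "U = {0..<int e}"
  have fin: "finite U" by (simp add: U_def)
  have pow: "[t ^ d = 1] (mod int e)"
    using assms(3,8) by (simp add: cong_power_eq_1_iff_ord_dvd_int)
  have f_dvd: "int e dvd y * (t ^ j - 1) \<longleftrightarrow> f y dvd j" for y j
    unfolding f_def by (rule dvd_mult_power_minus_1_iff_ord[OF assms(3)])
  have f: "f y dvd d" for y
    using pow by (simp flip: f_dvd add: cong_iff_dvd_diff)
  have \<alpha>: "\<alpha> j = card {y \<in> U. f y dvd j}" if "j > 0" for j
  proof -
    \<comment> \<open>The absolute value makes \<open>t ^ j - 1\<close> a natural number with the
      same divisors. The primes selected in \<open>\<alpha> j\<close> are those dividing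
      \<open>c\<close>, and their product is \<open>gcd e c\<close>.\<close>
    define c where "c = nat \<bar>t ^ j - 1\<bar>"
    have "ord_p i dvd j \<longleftrightarrow> p i dvd c" if i: "i \<in> {1..m}" for i
    proof -
      have "p i > 0" using assms(5)[OF i] by (rule prime_gt_0_nat)
      then have "ord_p i dvd j \<longleftrightarrow> int (p i) dvd t ^ j - 1"
        using assms(9)[OF i] by (simp add: cong_power_eq_1_iff_ord_dvd_int[symmetric] cong_iff_dvd_diff)
      also have "\<dots> \<longleftrightarrow> p i dvd c"
        by (simp add: c_def int_dvd_int_iff[symmetric])
      finally show ?thesis .
    qed
    then have "\<alpha> j = (\<Prod>i\<in>{i \<in> {1..m}. p i dvd c}. p i)"
      unfolding assms(10)[OF that] by (intro prod.cong) auto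
    also have "\<dots> = gcd e c"
      unfolding assms(7) using assms(5,6) by (intro gcd_prod_distinct_primes[symmetric]) auto
    also have "\<dots> = nat (gcd (t ^ j - 1) (int e))"
      by (simp only: c_def gcd_int_def abs_of_nat nat_int gcd.commute)
    also have "\<dots> = card {y \<in> U. f y dvd j}"
      using card_dvd_mult[OF assms(3), of "t ^ j - 1"] by (simp add: U_def f_dvd)
    finally show ?thesis .
  qed
  \<comment> \<open>The class number and both sums are each shown to equal
    \<open>d * total\<close>.\<close>
  define total where "total = (\<Sum>y\<in>U. 1 / real (f y) ^ 2)"
  have "real (d * card (conjugacy_classes (metacyclic_group d e t))) = real d ^ 2 * total"
    unfolding card_conjugacy_classes_metacyclic_group(2)[OF assms(2,3) pow] total_def
    using sum_card_common_multiples[of U f d, OF fin f] by (simp add: f_dvd flip: U_def)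
  then have "real (card (conjugacy_classes (metacyclic_group d e t))) = real d * total"
    using assms(2) by (simp add: power2_eq_square)
  moreover have "(\<Sum>k = 1..d. \<Sum>a = 1..d. 1 / real k *
          (\<Sum>l = 0..k - 1. (- 1) ^ l *
             (\<Sum>js \<in> {js. length js = l \<and> sorted_wrt (<) js \<and> set js \<subseteq> {1..<k}}.
                real (\<alpha> (Gcd ({d, a, k} \<union> set js)))))) = real d * total"
  proof -
    have "(\<Sum>l = 0..k - 1. (- 1) ^ l *
             (\<Sum>js \<in> {js. length js = l \<and> sorted_wrt (<) js \<and> set js \<subseteq> {1..<k}}.
                real (\<alpha> (Gcd ({d, a, k} \<union> set js)))))
      = (\<Sum>S\<in>Pow {1..<k}. (- 1) ^ card S * real (card {y \<in> U. f y dvd Gcd ({d, a, k} \<union> S)}))" for a k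
    proof -
      \<comment> \<open>\<open>\<alpha>\<close> is specified at positive arguments only; the entry
        \<open>d > 0\<close> keeps the gcd positive.\<close>
      have pos: "Gcd ({d, a, k} \<union> S) > 0" for S
        using assms(2) by (intro Nat.gr0I) (auto simp: Gcd_0_iff)
      show ?thesis
        by (subst sum_strict_sorted_lists[of "{1..<k}" "k - 1" "\<lambda>l. (- 1) ^ l"
              "\<lambda>S. real (\<alpha> (Gcd ({d, a, k} \<union> S)))"]) (simp_all only: \<alpha>[OF pos], simp_all)
    qed
    then show ?thesis
      unfolding total_def using sum_inclusion_exclusion_Gcd[of U f d, OF fin f assms(2)] by simp
  qed
  moreover have "real d * (\<Sum>j \<in> {j. j dvd d}. real (\<alpha> j) / real j ^ 2 *
          (\<Sum>s \<in> {s. s dvd d div j}. real_of_int (moebius s) / real s ^ 2)) = real d * total"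
  proof -
    have "real (\<alpha> j) = real (card {y \<in> U. f y dvd j})" if "j dvd d" for j
      using \<alpha>[of j] that assms(2) by (auto intro: Nat.gr0I)
    then show ?thesis
      unfolding total_def sum_card_moebius[of U f d, OF fin f assms(2), symmetric] by simp
  qed
  moreover have "finite (conjugacy_classes (metacyclic_group d e t))"
    by (rule card_conjugacy_classes_metacyclic_group(1)[OF assms(2,3) pow])
  ultimately show ?thesis by (simp only: simp_thms)
qed

end
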